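(* Let $p>n\ge2$. There exist constants $b=b(n,p)\ge1$ and $c=c(n,p)>0$ such that for every open ball $B_R\subset\mathbb{R}^n$ of radius $R>0$ and all $u\in C_c^\infty(B_R)$ $$\sup_{x,y\in B_R,\; x\neq y}\left\{\frac{|u(x)-u(y)|}{|x-y|^{1-n/p}}X^{1/p}\Big(\frac{|x-y|}{D}\Big)\right\}\le c\left(\int_{B_R}|\nabla u|^pdx-\Big(\frac{p-1}{p}\Big)^p\int_{B_R}\frac{|u|^p}{d^p}dx\right)^{1/p},$$ where $D=2bR$.
   Context: $d=d(x):=\operatorname{dist}(x,\mathbb{R}^n\setminus B_R)$. $X(t):=(1-\log t)^{-1}$ for $t\in(0,1]$, and $X^{1/p}(t)=(X(t))^{1/p}$. *)

theory Defs
  imports "HOL-Analysis.Analysis"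
begin

definition pderiv_dir :: "'n::finite \<Rightarrow> (real ^ 'n \<Rightarrow> real) \<Rightarrow> real ^ 'n \<Rightarrow> real" where
  "pderiv_dir i f x = frechet_derivative f (at x) (axis i 1)"

definition grad :: "(real ^ 'n::finite \<Rightarrow> real) \<Rightarrow> real ^ 'n \<Rightarrow> real ^ 'n" where
  "grad f x = (\<chi> i. pderiv_dir i f x)"

primrec continuously_diff :: "nat \<Rightarrow> (real ^ 'n::finite \<Rightarrow> real) \<Rightarrow> bool" where
  "continuously_diff 0 f \<longleftrightarrow> continuous_on UNIV f"
| "continuously_diff (Suc k) f \<longleftrightarrow>
     (\<forall>x. f differentiable (at x)) \<and> (\<forall>i. continuously_diff k (pderiv_dir i f))"

definition smooth :: "(real ^ 'n::finite \<Rightarrow> real) \<Rightarrow> bool" where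
  "smooth f \<longleftrightarrow> (\<forall>k. continuously_diff k f)"

(* Elements of C_c^\<infinity>(\<Omega>) are identified with their extensions by zero to the whole space. *)
definition test_functions :: "(real ^ 'n::finite) set \<Rightarrow> (real ^ 'n \<Rightarrow> real) set" where
  "test_functions \<Omega> = {u. smooth u \<and> compact (closure {x. u x \<noteq> 0}) \<and> closure {x. u x \<noteq> 0} \<subseteq> \<Omega>}"

definition dist_compl :: "(real ^ 'n::finite) set \<Rightarrow> real ^ 'n \<Rightarrow> real" where
  "dist_compl \<Omega> x = infdist x (- \<Omega>)"

(* Only meaningful for 0 < t \<le> 1. *)
definition X :: "real \<Rightarrow> real" where
  "X t = inverse (1 - ln t)"

definition hardy_difference :: "real \<Rightarrow> (real ^ 'n::finite) set \<Rightarrow> (real ^ 'n \<Rightarrow> real) \<Rightarrow> real" where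
  "hardy_difference p \<Omega> u =
     (LINT x:\<Omega>|lborel. norm (grad u x) powr p)
     - ((p - 1) / p) powr p * (LINT x:\<Omega>|lborel. \<bar>u x\<bar> powr p / dist_compl \<Omega> x powr p)"

end

theory Submission
  imports Defs
begin

text \<open>With $b = 1$ the factor $X^{1/p}$ is at most $1$, and for $n \ge 2$ the plain Hoelder estimate holds.
  Substituting $u = d^{1-1/p} v$ and using uniform convexity of $|\cdot|^p$, the Hardy difference $I$
  controls both $\int d^{p-1} |\nabla v|^p$ and, because $-\Delta d = (n-1)/|x - z|$ is bounded below,
  $R^{-1} \int |v|^p$. Morrey's inequality for $v$ on a ball of radius $d(x)$ compares $v(x)$ with $v$ at a
  point twice as far from the boundary, with error $d(x)^{-(n-1)/p} I^{1/p}$. Since $n \ge 2$ these errors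
  form a geometric series along the way to the centre, so $|u| \le C d^{1-n/p} I^{1/p}$. Inserting
  this into $\nabla u$ and applying Morrey's inequality to $u$ at distances below $d/2$ yields the claim.\<close>

section \<open>Convexity of powers of the norm\<close>

text \<open>The exponent \<open>\<theta>\<close> = 1 - 1/p is forced. With u = d^\<theta> v, the
  part of grad u proportional to grad d has the Hardy density as its p-th power, and the linear term
  of the convexity expansion is an exact multiple of the radial derivative of |v|^p. What survives
  integration is the remainder in d^\<theta> grad v and the term in |v|^p. The first controls only
  oscillations of v; the second supplies its size in the middle of the ball, where the chain of
  balls ends. The obstacle at the centre z is that d is not differentiable there. Radial integration
  by parts is therefore replaced by differentiating a dilation, Morrey's inequality for v is used
  only on balls that avoid z, and near z it is applied to the smooth function u itself. The
  geometric series need not be summed: one step contracts the normalised size of u by 2^(-(n-1)/p),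
  so a single step taken at a maximum point closes the estimate.\<close>

lemma powr_above_tangent:
  fixes r s q :: real
  assumes "r \<ge> 0" "s \<ge> 0" "q \<ge> 1"
  shows "s powr q \<ge> r powr q + q * r powr (q - 1) * (s - r)"
proof (cases "r = 0 \<or> s = 0")
  case True
  show ?thesis
  proof (cases "r = 0")
    case False
    then have "r powr (q - 1) * r = r powr q"
      using assms by (simp add: powr_diff)
    then have "r powr q + q * r powr (q - 1) * (s - r) = (1 - q) * r powr q"
      using True False by (simp add: algebra_simps)
    also have "\<dots> \<le> 0" using assms by (simp add: mult_nonpos_nonneg)
    finally show ?thesis using True False by simp
  qed (use True in simp)
next
  case False
  then have rs: "r > 0" "s > 0" using assms by auto
  have "s powr q - r powr q \<ge> q * r powr (q - 1) * (s - r)"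
  proof (rule convex_on_imp_above_tangent[OF powr_convex[OF assms(3)]])
    show "((\<lambda>x. x powr q) has_real_derivative q * r powr (q - 1)) (at r within {0<..})"
      using rs by (auto intro!: derivative_eq_intros)
  qed (use rs in \<open>auto simp: interior_open\<close>)
  then show ?thesis by simp
qed

lemma powr_midpoint_le:
  fixes x y q :: real
  assumes "x \<ge> 0" "y \<ge> 0" "q \<ge> 1"
  shows "((x + y) / 2) powr q \<le> (x powr q + y powr q) / 2"
proof -
  define m where "m = (x + y) / 2"
  have "m powr q + q * m powr (q - 1) * (x - m) \<le> x powr q"
       "m powr q + q * m powr (q - 1) * (y - m) \<le> y powr q"
    using assms by (auto intro!: powr_above_tangent simp: m_def)
  moreover have "q * m powr (q - 1) * (x - m) + q * m powr (q - 1) * (y - m) = 0"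
    unfolding distrib_left[symmetric] by (simp add: m_def)
  ultimately have "2 * m powr q \<le> x powr q + y powr q" by linarith
  then show ?thesis unfolding m_def by simp
qed

lemma powr_superadditive:
  fixes x y q :: real
  assumes "x \<ge> 0" "y \<ge> 0" "q \<ge> 1"
  shows "x powr q + y powr q \<le> (x + y) powr q"
proof -
  have *: "z powr q = z * z powr (q - 1)" if "z \<ge> 0" for z
    using that by (cases "z = 0") (simp_all add: powr_diff)
  have "x * x powr (q - 1) + y * y powr (q - 1) \<le> x * (x + y) powr (q - 1) + y * (x + y) powr (q - 1)"
    using assms by (intro add_mono mult_left_mono powr_mono2) auto
  then show ?thesis using *[of x] *[of y] *[of "x + y"] assms by (simp add: algebra_simps)
qed

text \<open>The parallelogram law handles squares. Writing |c|^p as (|c|^2)^(p/2), superadditivity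
  of t^(p/2) merges the left-hand side into one power and convexity splits the right-hand side
  again. This is a Clarkson inequality.\<close>

lemma norm_powr_uniform_convexity:
  fixes a b :: "'a::real_inner"
  assumes "p \<ge> 2"
  shows "norm ((1/2) *\<^sub>R (a + b)) powr p + norm ((1/2) *\<^sub>R (a - b)) powr p \<le> (norm a powr p + norm b powr p) / 2"
proof -
  have sq: "norm c powr p = ((norm c)\<^sup>2) powr (p / 2)" for c :: 'a
    by (cases "c = 0") (simp_all add: powr_powr flip: powr_numeral)
  have "norm ((1/2) *\<^sub>R (a + b)) powr p + norm ((1/2) *\<^sub>R (a - b)) powr p
     \<le> ((norm ((1/2) *\<^sub>R (a + b)))\<^sup>2 + (norm ((1/2) *\<^sub>R (a - b)))\<^sup>2) powr (p / 2)"
    unfolding sq using assms by (intro powr_superadditive) auto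
  also have "(norm ((1/2) *\<^sub>R (a + b)))\<^sup>2 + (norm ((1/2) *\<^sub>R (a - b)))\<^sup>2 = ((norm a)\<^sup>2 + (norm b)\<^sup>2) / 2"
    by (simp add: power2_norm_eq_inner algebra_simps inner_commute)
  also have "\<dots> powr (p / 2) \<le> (((norm a)\<^sup>2) powr (p / 2) + ((norm b)\<^sup>2) powr (p / 2)) / 2"
    using assms by (intro powr_midpoint_le) auto
  finally show ?thesis by (simp add: sq)
qed

text \<open>The vector p |a|^(p-2) a is the gradient of |.|^p at a, so this is a tangent inequality;
  Cauchy-Schwarz reduces it to one variable.\<close>

lemma norm_powr_add_ge:
  fixes a h :: "'a::real_inner"
  assumes "p \<ge> 2"
  shows "norm (a + h) powr p \<ge> norm a powr p + p * norm a powr (p - 2) * (a \<bullet> h)"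
proof (cases "a = 0")
  case False
  have "a \<bullet> (a + h) \<le> norm a * norm (a + h)" by (rule norm_cauchy_schwarz)
  then have "a \<bullet> h \<le> norm a * (norm (a + h) - norm a)"
    by (simp add: inner_add_right dot_square_norm power2_eq_square right_diff_distrib)
  then have "p * norm a powr (p - 2) * (a \<bullet> h) \<le> p * norm a powr (p - 2) * (norm a * (norm (a + h) - norm a))"
    using assms by (intro mult_left_mono) auto
  also have "\<dots> = p * norm a powr (p - 1) * (norm (a + h) - norm a)"
    using False by (simp add: powr_diff power2_eq_square)
  finally show ?thesis
    using powr_above_tangent[OF norm_ge_zero norm_ge_zero, of p a "a + h"] assms by linarith
qed simp

text \<open>Uniform convexity is applied to a + b and a. Their midpoint a + b/2 is bounded below by
  the tangent inequality, and the half-difference b/2 contributes 2^(-p) |b|^p, doubled when the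
  factor 1/2 is cleared.\<close>

lemma norm_powr_add_ge_remainder:
  fixes a b :: "'a::real_inner"
  assumes "p \<ge> 2"
  shows "norm (a + b) powr p
     \<ge> norm a powr p + p * norm a powr (p - 2) * (a \<bullet> b) + 2 powr (1 - p) * norm b powr p"
proof -
  have 1: "norm ((1/2) *\<^sub>R ((a + b) + a)) powr p + norm ((1/2) *\<^sub>R ((a + b) - a)) powr p
      \<le> (norm (a + b) powr p + norm a powr p) / 2"
    by (rule norm_powr_uniform_convexity[OF assms])
  have 2: "(1/2) *\<^sub>R ((a + b) + a) = a + (1/2) *\<^sub>R b"
    by (simp add: algebra_simps) (metis scaleR_half_double scaleR_add_right)
  have 3: "norm a powr p + p * norm a powr (p - 2) * (a \<bullet> ((1/2) *\<^sub>R b)) \<le> norm (a + (1/2) *\<^sub>R b) powr p"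
    by (rule norm_powr_add_ge[OF assms])
  have 4: "norm ((1/2) *\<^sub>R ((a + b) - a)) powr p = 2 powr (1 - p) * norm b powr p / 2"
    by (simp add: powr_divide powr_diff)
  have 5: "p * norm a powr (p - 2) * (a \<bullet> ((1/2) *\<^sub>R b)) = (p * norm a powr (p - 2) * (a \<bullet> b)) / 2"
    by simp
  have arith: "A + q + e \<le> S" if "T + e / 2 \<le> (S + A) / 2" "A + q / 2 \<le> T" for A q e S T :: real
    using that by (simp add: field_simps)
  show ?thesis using arith[OF 1[unfolded 2 4] 3[unfolded 5]] .
qed

section \<open>Dilations and radial derivatives\<close>

lemma nn_integral_lborel_affine:
  fixes f :: "'a::euclidean_space \<Rightarrow> ennreal"
  assumes [measurable]: "f \<in> borel_measurable borel" and "c \<noteq> 0"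
  shows "(\<integral>\<^sup>+x. f x \<partial>lborel) = ennreal (\<bar>c\<bar> ^ DIM('a)) * (\<integral>\<^sup>+x. f (t + c *\<^sub>R x) \<partial>lborel)"
  by (subst lborel_affine[OF \<open>c \<noteq> 0\<close>, of t])
     (simp add: nn_integral_density nn_integral_distr nn_integral_cmult ennreal_power)

lemma integral_lborel_affine:
  fixes f :: "'a::euclidean_space \<Rightarrow> real"
  assumes [measurable]: "f \<in> borel_measurable borel" and "c \<noteq> 0"
  shows "(\<integral>x. f x \<partial>lborel) = \<bar>c\<bar> ^ DIM('a) * (\<integral>x. f (t + c *\<^sub>R x) \<partial>lborel)"
  by (subst lborel_affine[OF \<open>c \<noteq> 0\<close>, of t])
     (simp add: integral_density integral_distr)

lemma integrable_compact_support:
  fixes f :: "'a::euclidean_space \<Rightarrow> real"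
  assumes "continuous_on UNIV f" "compact S" "\<And>x. x \<notin> S \<Longrightarrow> f x = 0"
  shows "integrable lborel f"
proof -
  have "integrable lborel (\<lambda>x. indicator S x *\<^sub>R f x)"
    using assms by (intro borel_integrable_compact) (auto intro: continuous_on_subset)
  also have "(\<lambda>x. indicator S x *\<^sub>R f x) = f"
    using assms by (auto simp: fun_eq_iff indicator_def)
  finally show ?thesis .
qed

text \<open>Differentiates $t \mapsto \int w(z + t(x - z))\,|x - z|^{-1}\,dx = t^{1-n} \int w\,|x - z|^{-1}$ at $t = 1$;
  the weight is truncated to $\max(|x - z|, \varepsilon)^{-1}$ to avoid integrability questions at $z$.\<close>
lemma integral_radial_derivative_le:
  fixes w :: "'a::euclidean_space \<Rightarrow> real" and W :: "'a \<Rightarrow> 'a"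
  assumes dim: "DIM('a) \<ge> 2" and R: "R > 0"
    and cont: "continuous_on UNIV w" and nonneg: "\<And>x. w x \<ge> 0"
    and supp: "\<And>x. norm (x - z) \<ge> R \<Longrightarrow> w x = 0"
    and der: "\<And>x. x \<noteq> z \<Longrightarrow> (w has_derivative (\<lambda>h. W x \<bullet> h)) (at x)"
    and bound: "\<And>x. x \<noteq> z \<Longrightarrow> norm (W x) \<le> L"
    and meas: "W \<in> borel_measurable borel"
  shows "integrable lborel (\<lambda>x. W x \<bullet> sgn (x - z))"
    and "(\<integral>x. W x \<bullet> sgn (x - z) \<partial>lborel) \<le> - (1 / R) * (\<integral>x. w x \<partial>lborel)"
proof -
  define h where "h k = inverse (real (Suc k))" for k
  have h0: "h k > 0" for k by (simp add: h_def)
  have hlim: "h \<longlonglongrightarrow> 0" unfolding h_def by (rule LIMSEQ_inverse_real_of_nat)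
  define m where "m k x = 1 / max (norm (x - z)) (h k)" for k and x :: 'a
  \<comment> \<open>\<open>y k\<close> dilates about \<open>z\<close> by the factor 1 + h k;
    \<open>F k\<close> is the difference quotient of \<open>w\<close> along this dilation, weighted
    so that it tends to the radial derivative.\<close>
  define y where "y k x = z + (1 + h k) *\<^sub>R (x - z)" for k and x :: 'a
  define F where "F k x = (w (y k x) - w x) / h k * m k x" for k x
  have mpos: "max (norm (x - z)) (h k) > 0" for k x using h0[of k] by auto
  have wm[measurable]: "w \<in> borel_measurable borel"
    using cont by (rule borel_measurable_continuous_onI)
  note meas[measurable]
  have mm[measurable]: "m k \<in> borel_measurable borel" for k
    unfolding m_def[abs_def] by measurable
  have ym[measurable]: "y k \<in> borel_measurable borel" for k
    unfolding y_def[abs_def] by measurable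
  have Fm[measurable]: "F k \<in> borel_measurable borel" for k
    unfolding F_def[abs_def] by measurable
  have L0: "L \<ge> 0"
  proof -
    obtain v :: 'a where "norm v = 1" using vector_choose_size[of 1] by auto
    then have "z + v \<noteq> z" by auto
    then show ?thesis using bound norm_ge_zero order_trans by blast
  qed
  have norm_y: "norm (y k x - z) = (1 + h k) * norm (x - z)" for k x
    using h0[of k] by (simp add: y_def)
  have lip: "\<bar>w (y k x) - w x\<bar> \<le> L * (h k * norm (x - z))" for k x
  proof (cases "x = z")
    case False
    have "norm (w (y k x) - w x) \<le> L * norm (y k x - x)"
    proof (rule differentiable_bound[of "closed_segment x (y k x)" w "\<lambda>v h. W v \<bullet> h" L])
      fix v assume "v \<in> closed_segment x (y k x)"
      then obtain s where s: "0 \<le> s" "s \<le> 1" "v = (1 - s) *\<^sub>R x + s *\<^sub>R y k x"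
        by (auto simp: closed_segment_def)
      have "v - z = (1 + s * h k) *\<^sub>R (x - z)"
        unfolding s y_def by (simp add: algebra_simps)
      moreover have "1 + s * h k > 0" using s h0[of k] by (simp add: add_pos_nonneg)
      ultimately have "v \<noteq> z" using False by auto
      then show "(w has_derivative (\<lambda>h. W v \<bullet> h)) (at v within closed_segment x (y k x))"
        using der has_derivative_at_withinI by blast
      show "onorm (\<lambda>h. W v \<bullet> h) \<le> L"
        using bound[OF \<open>v \<noteq> z\<close>]
        by (intro onorm_bound L0) (auto intro: order_trans[OF Cauchy_Schwarz_ineq2 mult_right_mono])
    qed auto
    also have "y k x - x = h k *\<^sub>R (x - z)" by (simp add: y_def algebra_simps)
    finally show ?thesis using h0[of k] by simp
  qed (simp add: y_def)
  \<comment> \<open>The increment of \<open>w\<close> is at most L h k |x - z|; dividing by h k and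
    multiplying by the weight removes both factors. Dominated convergence rests on this uniform
    bound.\<close>
  have Fbound: "norm (F k x) \<le> L * indicator (ball z R) x" for k x
  proof (cases "norm (x - z) < R")
    case False
    moreover have "norm (x - z) \<le> norm (y k x - z)"
      unfolding norm_y using h0[of k] by (simp add: algebra_simps)
    ultimately show ?thesis using supp by (simp add: F_def dist_norm norm_minus_commute)
  next
    case True
    have "norm (F k x) = \<bar>w (y k x) - w x\<bar> / (h k * max (norm (x - z)) (h k))"
      using h0[of k] mpos[of x k] by (simp add: F_def m_def abs_mult)
    also have "\<dots> \<le> L * (h k * norm (x - z)) / (h k * max (norm (x - z)) (h k))"
      using h0[of k] mpos[of x k] by (intro divide_right_mono lip) auto
    also have "\<dots> \<le> L"
      using h0[of k] mpos[of x k] L0 by (simp add: divide_le_eq mult_left_mono)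
    finally show ?thesis using True by (simp add: dist_norm norm_minus_commute)
  qed
  have Flim: "(\<lambda>k. F k x) \<longlonglongrightarrow> W x \<bullet> sgn (x - z)" if "x \<noteq> z" for x
  proof -
    have "((\<lambda>t. w (z + t *\<^sub>R (x - z))) has_derivative (\<lambda>s. W x \<bullet> (s *\<^sub>R (x - z)))) (at 1)"
      by (rule has_derivative_compose[of "\<lambda>t. z + t *\<^sub>R (x - z)" "\<lambda>s. s *\<^sub>R (x - z)" 1 UNIV w, simplified])
         (auto intro!: derivative_eq_intros der that)
    then have "((\<lambda>t. w (z + t *\<^sub>R (x - z))) has_real_derivative W x \<bullet> (x - z)) (at 1)"
      by (simp add: has_field_derivative_def mult_commute_abs)
    then have "(\<lambda>a. (w (z + (1 + a) *\<^sub>R (x - z)) - w (z + 1 *\<^sub>R (x - z))) / a) \<midarrow>0\<rightarrow> W x \<bullet> (x - z)"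
      by (simp add: DERIV_def)
    moreover have "filterlim h (at 0) sequentially"
      using hlim h0 by (auto simp: filterlim_at order_less_imp_not_eq2)
    ultimately have 1: "(\<lambda>k. (w (y k x) - w x) / h k) \<longlonglongrightarrow> W x \<bullet> (x - z)"
      using filterlim_compose by (fastforce simp: y_def)
    have "(\<lambda>k. m k x) \<longlonglongrightarrow> 1 / max (norm (x - z)) 0"
      unfolding m_def using that by (intro tendsto_intros hlim) auto
    from tendsto_mult[OF 1 this] that show ?thesis
      by (simp add: F_def sgn_div_norm divide_inverse mult.commute)
  qed
  have dom: "integrable lborel (\<lambda>x. L * indicator (ball z R) x :: real)"
    using emeasure_bounded_finite[OF bounded_ball, of z R]
    by (intro integrable_mult_right integrable_real_indicator) auto
  have AElim: "AE x in lborel. (\<lambda>k. F k x) \<longlonglongrightarrow> W x \<bullet> sgn (x - z)"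
    using AE_lborel_singleton[of z] by eventually_elim (rule Flim)
  have lm: "(\<lambda>x. W x \<bullet> sgn (x - z)) \<in> borel_measurable lborel"
    unfolding sgn_div_norm by measurable
  note dct = lm _ dom AElim
  show "integrable lborel (\<lambda>x. W x \<bullet> sgn (x - z))"
    by (rule integrable_dominated_convergence[OF dct]) (simp_all add: Fbound[unfolded real_norm_def])
  have lim: "(\<lambda>k. \<integral>x. F k x \<partial>lborel) \<longlonglongrightarrow> (\<integral>x. W x \<bullet> sgn (x - z) \<partial>lborel)"
    by (rule integral_dominated_convergence[OF dct]) (simp_all add: Fbound[unfolded real_norm_def])
  \<comment> \<open>The change of variables gives c^(-n) and the weight gives back at most one c, so
    the total is at most c^(1-n) \<le> 1/c; this is where n \<ge> 2 enters. For h k \<le> R the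
    weight is at least 1/R on the ball.\<close>
  have Fint: "(\<integral>x. F k x \<partial>lborel) \<le> - (1 / ((1 + h k) * R)) * (\<integral>x. w x \<partial>lborel)" if "h k \<le> R" for k
  proof -
    define c where "c = 1 + h k"
    have c: "c > 1" "c = 1 + h k" using h0[of k] by (auto simp: c_def)
    have S: "compact (cball z R)" by simp
    have S0: "w x = 0" if "x \<notin> cball z R" for x
      using that supp[of x] by (auto simp: dist_norm norm_minus_commute)
    have S1: "w (y k x) = 0" if "x \<notin> cball z R" for x
    proof (rule supp)
      have "R * 1 \<le> norm (x - z) * c" using that c R
        by (intro mult_mono) (auto simp: dist_norm norm_minus_commute)
      then show "norm (y k x - z) \<ge> R" by (simp add: norm_y c(2) mult.commute)
    qed
    have mc: "continuous_on UNIV (m k)" unfolding m_def[abs_def]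
      using mpos[of _ k] by (intro continuous_intros) (auto simp: less_imp_neq[THEN not_sym] order_less_imp_not_eq2)
    have yc: "continuous_on UNIV (y k)" unfolding y_def[abs_def] by (intro continuous_intros)
    have i1: "integrable lborel (\<lambda>x. w (y k x) * m k x)"
      by (rule integrable_compact_support[OF _ S])
         (auto intro!: continuous_intros mc continuous_on_compose2[OF cont yc] simp: S1)
    have i2: "integrable lborel (\<lambda>x. w x * m k x)"
      by (rule integrable_compact_support[OF _ S]) (auto intro!: continuous_intros mc cont simp: S0)
    have i3: "integrable lborel w"
      by (rule integrable_compact_support[OF cont S]) (auto simp: S0)
    have i4: "integrable lborel (\<lambda>x. c * (w (y k x) * m k (y k x)))"
      by (rule integrable_compact_support[OF _ S])
         (auto intro!: continuous_intros continuous_on_compose2[OF mc yc] continuous_on_compose2[OF cont yc] simp: S1)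
    have "(\<integral>x. w (y k x) * m k x \<partial>lborel) \<le> (\<integral>x. c * (w (y k x) * m k (y k x)) \<partial>lborel)"
    proof (rule integral_mono[OF i1 i4])
      fix x
      have "max (norm (y k x - z)) (h k) \<le> c * max (norm (x - z)) (h k)"
      proof (rule max.boundedI)
        have "1 * max (norm (x - z)) (h k) \<le> c * max (norm (x - z)) (h k)"
          using c(1) mpos[of x k] by (intro mult_right_mono) linarith+
        then show "h k \<le> c * max (norm (x - z)) (h k)" by simp
      qed (use c in \<open>simp add: norm_y\<close>)
      then have "m k x \<le> c * m k (y k x)"
        using mpos[of x k] mpos[of "y k x" k] by (simp add: m_def field_simps)
      then show "w (y k x) * m k x \<le> c * (w (y k x) * m k (y k x))"
        using nonneg[of "y k x"] by (metis mult.left_commute mult_left_mono)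
    qed
    also have "\<dots> = c * (\<integral>x. w (y k x) * m k (y k x) \<partial>lborel)" by simp
    also have "\<dots> \<le> (1 / c) * (\<integral>x. w x * m k x \<partial>lborel)"
    proof -
      define J where "J = (\<integral>x. w (y k x) * m k (y k x) \<partial>lborel)"
      have J0: "J \<ge> 0" unfolding J_def using nonneg mpos
        by (intro integral_nonneg_AE) (auto simp: m_def less_imp_le)
      have "(\<integral>x. w x * m k x \<partial>lborel) = c ^ DIM('a) * J"
        using c integral_lborel_affine[of "\<lambda>x. w x * m k x" c "z - c *\<^sub>R z"]
        by (simp add: J_def y_def[abs_def] algebra_simps)
      moreover have "c\<^sup>2 * J \<le> c ^ DIM('a) * J"
        using J0 c dim by (intro mult_right_mono power_increasing) auto
      ultimately show ?thesis using c J_def by (simp add: field_simps power2_eq_square)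
    qed
    finally have 1: "(\<integral>x. w (y k x) * m k x \<partial>lborel) \<le> (1 / c) * (\<integral>x. w x * m k x \<partial>lborel)" .
    have "(\<integral>x. (1 / R) * w x \<partial>lborel) \<le> (\<integral>x. w x * m k x \<partial>lborel)"
    proof (rule integral_mono)
      fix x show "(1 / R) * w x \<le> w x * m k x"
      proof (cases "norm (x - z) < R")
        case True
        then have "1 / R \<le> m k x" using mpos[of x k] that
          by (simp add: m_def frac_le)
        then show ?thesis using nonneg[of x] mult_left_mono by (metis mult.commute)
      qed (use supp[of x] in auto)
    qed (use i2 i3 in auto)
    then have 2: "(1 / R) * (\<integral>x. w x \<partial>lborel) \<le> (\<integral>x. w x * m k x \<partial>lborel)" by simp
    have "(\<integral>x. F k x \<partial>lborel) = (\<integral>x. (1 / h k) * (w (y k x) * m k x - w x * m k x) \<partial>lborel)"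
      by (rule Bochner_Integration.integral_cong) (auto simp: F_def field_simps)
    also have "\<dots> = (1 / h k) * ((\<integral>x. w (y k x) * m k x \<partial>lborel) - (\<integral>x. w x * m k x \<partial>lborel))"
      using i1 i2 by simp
    also have "\<dots> \<le> (1 / h k) * ((1 / c) * (\<integral>x. w x * m k x \<partial>lborel) - (\<integral>x. w x * m k x \<partial>lborel))"
      using 1 h0[of k] by (intro mult_left_mono) auto
    also have "\<dots> = - (1 / c) * (\<integral>x. w x * m k x \<partial>lborel)"
      using c h0[of k] by (simp add: field_simps)
    also have "\<dots> \<le> - (1 / c) * ((1 / R) * (\<integral>x. w x \<partial>lborel))"
      using 2 c by (intro mult_left_mono_neg) auto
    finally show ?thesis by (simp add: c_def)
  qed
  show "(\<integral>x. W x \<bullet> sgn (x - z) \<partial>lborel) \<le> - (1 / R) * (\<integral>x. w x \<partial>lborel)"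
  proof (rule tendsto_le[OF _ _ lim])
    have "(\<lambda>k. - (1 / ((1 + h k) * R)) * (\<integral>x. w x \<partial>lborel)) \<longlonglongrightarrow> - (1 / ((1 + 0) * R)) * (\<integral>x. w x \<partial>lborel)"
      using R by (intro tendsto_intros hlim) auto
    then show "(\<lambda>k. - (1 / ((1 + h k) * R)) * (\<integral>x. w x \<partial>lborel)) \<longlonglongrightarrow> - (1 / R) * (\<integral>x. w x \<partial>lborel)"
      by simp
    have "\<forall>\<^sub>F k in sequentially. h k < R" using order_tendstoD(2)[OF hlim R] .
    then show "\<forall>\<^sub>F k in sequentially. (\<integral>x. F k x \<partial>lborel) \<le> - (1 / ((1 + h k) * R)) * (\<integral>x. w x \<partial>lborel)"
      by eventually_elim (rule Fint, simp)
  qed simp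
qed

section \<open>Morrey's inequality on balls\<close>

text \<open>Either s \<le> l, or s/l is at most its p-th power. With the free level l chosen well,
  this elementary bound does the work of Hoelder's inequality in the Morrey estimate.\<close>

lemma le_add_powr:
  fixes s l p :: real
  assumes "s \<ge> 0" "l > 0" "p \<ge> 1"
  shows "s \<le> l + l powr (1 - p) * s powr p"
proof (cases "s \<le> l")
  case False
  then have "l powr (p - 1) \<le> s powr (p - 1)" using assms by (intro powr_mono2) auto
  then have "s * l powr (p - 1) \<le> s * s powr (p - 1)" using assms by (intro mult_left_mono)
  also have "\<dots> = s powr p" using False assms by (simp add: powr_diff)
  finally have "s \<le> s powr p / l powr (p - 1)" using assms by (simp add: pos_le_divide_eq)
  also have "\<dots> = l powr (1 - p) * s powr p"
    using assms by (simp add: powr_diff divide_simps)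
  finally show ?thesis using assms by linarith
next
  case True
  then show ?thesis using assms by (intro add_increasing2) auto
qed

lemma has_integral_indicator_times:
  fixes g :: "'a::euclidean_space \<Rightarrow> real"
  shows "((\<lambda>t. indicator A t * g t) has_integral I) UNIV \<longleftrightarrow> (g has_integral I) A"
proof -
  have "(\<lambda>t. indicator A t * g t) = (\<lambda>t. if t \<in> A then g t else 0)" by auto
  then show ?thesis by (simp only: has_integral_restrict_UNIV)
qed

lemma nn_integral_powr_unit_interval:
  assumes "a < 1"
  shows "(\<integral>\<^sup>+t\<in>{0..1}. ennreal (t powr (- a)) \<partial>lborel) = ennreal (1 / (1 - a))"
proof -
  have "((\<lambda>t. t powr (- a)) has_integral (1 powr (- a + 1) / (- a + 1))) {0..1}"
    using assms by (intro has_integral_powr_from_0) auto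
  then have "((\<lambda>t. indicator {0..1} t * t powr (- a)) has_integral (1 / (1 - a))) UNIV"
    by (simp add: has_integral_indicator_times)
  then have "(\<integral>\<^sup>+t. ennreal (indicator {0..1} t * t powr (- a)) \<partial>lborel) = ennreal (1 / (1 - a))"
    by (intro nn_integral_has_integral_lborel) auto
  then show ?thesis by (simp add: ennreal_mult' ennreal_indicator mult.commute)
qed

text \<open>The fundamental theorem of calculus along the segment. The bound is a nonnegative
  integral so that Tonelli's theorem can later exchange it with the integral over y.\<close>

lemma abs_diff_le_nn_integral_segment:
  fixes f :: "'a::euclidean_space \<Rightarrow> real"
  assumes Q: "convex Q" "x \<in> Q" "y \<in> Q" and cont: "continuous_on Q G"
    and der: "\<And>v. v \<in> Q \<Longrightarrow> (f has_derivative (\<lambda>h. G v \<bullet> h)) (at v within Q)"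
  shows "ennreal \<bar>f y - f x\<bar>
    \<le> (\<integral>\<^sup>+t\<in>{0..1}. ennreal (norm (G (x + t *\<^sub>R (y - x))) * norm (y - x)) \<partial>lborel)"
proof -
  define \<gamma> where "\<gamma> t = x + t *\<^sub>R (y - x)" for t
  have \<gamma>: "\<gamma> t \<in> Q" if "t \<in> {0..1}" for t
    using convexD_alt[OF Q(1,2,3), of t] that by (simp add: \<gamma>_def algebra_simps)
  have \<gamma>c: "continuous_on {0..1} \<gamma>" unfolding \<gamma>_def by (intro continuous_intros)
  have Gc: "continuous_on {0..1} (\<lambda>t. G (\<gamma> t))"
    by (rule continuous_on_compose2[OF cont \<gamma>c]) (use \<gamma> in auto)
  have "((\<lambda>t. G (\<gamma> t) \<bullet> (y - x)) has_integral (f (\<gamma> 1) - f (\<gamma> 0))) {0..1}"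
  proof (rule fundamental_theorem_of_calculus)
    fix t :: real assume t: "t \<in> {0..1}"
    have "(\<gamma> has_derivative (\<lambda>s. s *\<^sub>R (y - x))) (at t within {0..1})"
      unfolding \<gamma>_def by (auto intro!: derivative_eq_intros)
    moreover have "\<gamma> ` {0..1} \<subseteq> Q" using \<gamma> by blast
    ultimately
    have "((\<lambda>t. f (\<gamma> t)) has_derivative (\<lambda>s. G (\<gamma> t) \<bullet> (s *\<^sub>R (y - x)))) (at t within {0..1})"
      using has_derivative_in_compose2[where t = Q, OF der] t by blast
    then show "((\<lambda>t. f (\<gamma> t)) has_vector_derivative G (\<gamma> t) \<bullet> (y - x)) (at t within {0..1})"
      by (simp add: has_vector_derivative_def)
  qed simp
  then have hi: "((\<lambda>t. G (\<gamma> t) \<bullet> (y - x)) has_integral (f y - f x)) {0..1}"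
    by (simp add: \<gamma>_def)
  have hj: "((\<lambda>t. norm (G (\<gamma> t)) * norm (y - x)) has_integral
      integral {0..1} (\<lambda>t. norm (G (\<gamma> t)) * norm (y - x))) {0..1}"
    by (intro integrable_integral integrable_continuous_real continuous_intros Gc)
  have "\<bar>f y - f x\<bar> \<le> integral {0..1} (\<lambda>t. norm (G (\<gamma> t)) * norm (y - x))"
    using integral_norm_bound_integral[of "\<lambda>t. G (\<gamma> t) \<bullet> (y - x)" "{0..1}" "\<lambda>t. norm (G (\<gamma> t)) * norm (y - x)"]
      hi hj Cauchy_Schwarz_ineq2 by (auto simp: integrable_on_def integral_unique)
  also have "ennreal (integral {0..1} (\<lambda>t. norm (G (\<gamma> t)) * norm (y - x))) =
      (\<integral>\<^sup>+t. ennreal (indicator {0..1} t * (norm (G (\<gamma> t)) * norm (y - x))) \<partial>lborel)"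
  proof (rule nn_integral_has_integral_lborel[symmetric])
    have "(\<lambda>t. indicator {0..1} t *\<^sub>R (norm (G (\<gamma> t)) * norm (y - x))) \<in> borel_measurable borel"
      by (intro borel_measurable_continuous_on_indicator continuous_intros Gc) auto
    then show "(\<lambda>t. indicator {0..1} t * (norm (G (\<gamma> t)) * norm (y - x))) \<in> borel_measurable borel"
      by simp
    show "((\<lambda>t. indicator {0..1} t * (norm (G (\<gamma> t)) * norm (y - x))) has_integral
      integral {0..1} (\<lambda>t. norm (G (\<gamma> t)) * norm (y - x))) UNIV"
      using hj by (simp add: has_integral_indicator_times)
  qed auto
  also have "\<dots> = (\<integral>\<^sup>+t\<in>{0..1}. ennreal (norm (G (x + t *\<^sub>R (y - x))) * norm (y - x)) \<partial>lborel)"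
    by (simp add: \<gamma>_def ennreal_mult' ennreal_indicator mult.commute)
  finally show ?thesis by (simp add: ennreal_leI)
qed

text \<open>After Tonelli, the slice at fixed t sees the ball contracted towards x by the factor t,
  at the cost t^(-n). With the level of \<open>le_add_powr\<close> tuned to t, the slice is of order
  t^(-n/p), which is integrable at 0 because p > n.\<close>

lemma nn_integral_diff_cball_le:
  fixes f :: "'a::euclidean_space \<Rightarrow> real"
  assumes p: "p > real DIM('a)" and \<rho>: "\<rho> > 0" and x: "x \<in> cball c \<rho>"
    and cont: "continuous_on (cball c \<rho>) G"
    and der: "\<And>v. v \<in> cball c \<rho> \<Longrightarrow> (f has_derivative (\<lambda>h. G v \<bullet> h)) (at v within cball c \<rho>)"
    and E: "E > 0" and int: "(\<integral>\<^sup>+v\<in>cball c \<rho>. ennreal (norm (G v) powr p) \<partial>lborel) \<le> ennreal E"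
    and V: "V = measure lborel (cball c \<rho>)"
  shows "(\<integral>\<^sup>+y\<in>cball c \<rho>. ennreal \<bar>f y - f x\<bar> \<partial>lborel)
    \<le> ennreal (V * (4 * \<rho> / (1 - DIM('a) / p) * (E / V) powr (1 / p)))"
proof -
  define Q where "Q = cball c \<rho>"
  define n where "n = DIM('a)"
  define \<beta> where "\<beta> = n / p"
  have p1: "p > 1" using p DIM_positive[where 'a='a] by linarith
  have \<beta>: "\<beta> < 1" using p p1 by (simp add: \<beta>_def n_def)
  have Qm[measurable]: "Q \<in> sets borel" by (simp add: Q_def)
  have V0: "V > 0" unfolding V using \<rho> content_cball_pos[of \<rho> c] by simp
  have VQ: "emeasure lborel Q = ennreal V"
    using emeasure_bounded_finite[OF bounded_cball, of c \<rho>]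
    by (simp add: V Q_def emeasure_eq_ennreal_measure)
  \<comment> \<open>If \<open>E\<close> is the energy of G, this is the p-mean of |G| over the ball;
    \<open>lp\<close> states that the two terms of \<open>le_add_powr\<close>, integrated over the
    ball, balance at this level.\<close>
  define l where "l = (E / V) powr (1 / p)"
  have l: "l > 0" using E V0 by (simp add: l_def)
  have lp: "l powr (1 - p) * E = l * V"
    using E V0 p1 l by (simp add: powr_diff l_def powr_powr)
  \<comment> \<open>Extension by zero, so that the contraction can be undone by a change of
    variables on the whole space.\<close>
  define \<phi> where "\<phi> v = indicator Q v *\<^sub>R norm (G v)" for v
  have \<phi>m[measurable]: "\<phi> \<in> borel_measurable borel" unfolding \<phi>_def[abs_def] Q_def
    by (intro borel_measurable_continuous_on_indicator continuous_intros cont) auto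
  have \<phi>0: "\<phi> v \<ge> 0" for v by (simp add: \<phi>_def)
  have conv: "x + t *\<^sub>R (y - x) \<in> Q" if "t \<in> {0..1}" "y \<in> Q" for t y
    using convexD_alt[OF convex_cball x, of y t] that by (simp add: Q_def algebra_simps)
  have path: "ennreal \<bar>f y - f x\<bar> * indicator Q y \<le>
      (\<integral>\<^sup>+t. ennreal (2 * \<rho> * \<phi> (x + t *\<^sub>R (y - x))) * indicator {0..1} t * indicator Q y \<partial>lborel)" for y
  proof (cases "y \<in> Q")
    case True
    have "norm (y - x) \<le> dist y c + dist c x"
      using dist_triangle[of y x c] by (simp add: dist_norm)
    then have xy: "norm (y - x) \<le> 2 * \<rho>" using True x by (simp add: Q_def dist_commute)
    have "ennreal \<bar>f y - f x\<bar>
      \<le> (\<integral>\<^sup>+t\<in>{0..1}. ennreal (norm (G (x + t *\<^sub>R (y - x))) * norm (y - x)) \<partial>lborel)"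
      using True x by (intro abs_diff_le_nn_integral_segment[of Q] cont[folded Q_def] der[folded Q_def])
        (auto simp: Q_def)
    also have "\<dots> \<le> (\<integral>\<^sup>+t\<in>{0..1}. ennreal (2 * \<rho> * \<phi> (x + t *\<^sub>R (y - x))) \<partial>lborel)"
      using conv[OF _ True] xy
      by (intro nn_integral_mono) (auto simp: indicator_def \<phi>_def mult.commute intro!: ennreal_leI mult_right_mono)
    finally show ?thesis using True by simp
  qed simp
  have inner: "(\<integral>\<^sup>+y. ennreal (2 * \<rho> * \<phi> (x + t *\<^sub>R (y - x))) * indicator {0..1} t * indicator Q y \<partial>lborel)
      \<le> ennreal (4 * \<rho> * (l * V)) * (ennreal (t powr (- \<beta>)) * indicator {0..1} t)" if "t \<noteq> 0" for t
  proof (cases "t \<in> {0..1}")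
    case True
    with that have t: "0 < t" "t \<le> 1" by auto
    \<comment> \<open>Scaling the level by t^(-\<beta>) preserves the balance for every t: both
      \<mu> V and \<mu>^(1-p) t^(-n) E equal l V t^(-\<beta>).\<close>
    define \<mu> where "\<mu> = l * t powr (- \<beta>)"
    have \<mu>: "\<mu> > 0" using l t by (simp add: \<mu>_def)
    have *: "(\<integral>\<^sup>+v. ennreal (\<phi> v powr p) \<partial>lborel)
      = ennreal (t ^ n) * (\<integral>\<^sup>+y. ennreal (\<phi> (x + t *\<^sub>R (y - x)) powr p) \<partial>lborel)"
      using nn_integral_lborel_affine[of "\<lambda>v. ennreal (\<phi> v powr p)" t "x - t *\<^sub>R x"] t
      by (simp add: algebra_simps n_def)
    have "(\<integral>\<^sup>+y. ennreal (\<phi> (x + t *\<^sub>R (y - x)) powr p) \<partial>lborel)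
       = ennreal (1 / t ^ n) * (ennreal (t ^ n) * (\<integral>\<^sup>+y. ennreal (\<phi> (x + t *\<^sub>R (y - x)) powr p) \<partial>lborel))"
      using t by (simp add: mult.assoc[symmetric] ennreal_mult'[symmetric])
    also have "\<dots> = ennreal (1 / t ^ n) * (\<integral>\<^sup>+v\<in>Q. ennreal (norm (G v) powr p) \<partial>lborel)"
      unfolding *[symmetric] using p1
      by (intro arg_cong[where f="\<lambda>X. _ * X"] nn_integral_cong) (simp add: \<phi>_def indicator_def)
    also have "\<dots> \<le> ennreal (1 / t ^ n) * ennreal E"
      using int by (intro mult_left_mono) (auto simp: Q_def)
    also have "\<dots> = ennreal (t powr (- n) * E)"
      using t E by (simp add: ennreal_mult'[symmetric] powr_minus_divide powr_realpow)
    finally have A: "(\<integral>\<^sup>+y. ennreal (\<phi> (x + t *\<^sub>R (y - x)) powr p) \<partial>lborel) \<le> ennreal (t powr (- n) * E)" .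
    have "(\<integral>\<^sup>+y. ennreal (2 * \<rho> * \<phi> (x + t *\<^sub>R (y - x))) * indicator {0..1} t * indicator Q y \<partial>lborel)
      \<le> (\<integral>\<^sup>+y. ennreal (2 * \<rho>) * (ennreal \<mu> * indicator Q y
            + ennreal (\<mu> powr (1 - p)) * ennreal (\<phi> (x + t *\<^sub>R (y - x)) powr p)) \<partial>lborel)"
      (is "_ \<le> (\<integral>\<^sup>+y. ?R y \<partial>lborel)")
    proof (rule nn_integral_mono)
      fix y
      show "ennreal (2 * \<rho> * \<phi> (x + t *\<^sub>R (y - x))) * indicator {0..1} t * indicator Q y \<le> ?R y"
      proof (cases "y \<in> Q")
        case True
        have "2 * \<rho> * \<phi> (x + t *\<^sub>R (y - x))
            \<le> 2 * \<rho> * (\<mu> + \<mu> powr (1 - p) * \<phi> (x + t *\<^sub>R (y - x)) powr p)"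
          using \<rho> p1 by (intro mult_left_mono le_add_powr \<phi>0 \<mu>) auto
        then have "ennreal (2 * \<rho> * \<phi> (x + t *\<^sub>R (y - x)))
            \<le> ennreal (2 * \<rho> * (\<mu> + \<mu> powr (1 - p) * \<phi> (x + t *\<^sub>R (y - x)) powr p))"
          by (rule ennreal_leI)
        also have "\<dots> = ?R y" using \<rho> \<mu> True
          by (simp add: ennreal_mult' ennreal_plus)
        finally show ?thesis using t True by simp
      qed simp
    qed
    also have "\<dots> = ennreal (2 * \<rho>) * (ennreal \<mu> * ennreal V
        + ennreal (\<mu> powr (1 - p)) * (\<integral>\<^sup>+y. ennreal (\<phi> (x + t *\<^sub>R (y - x)) powr p) \<partial>lborel))"
      by (simp add: nn_integral_cmult nn_integral_add VQ)
    also have "\<dots> \<le> ennreal (2 * \<rho>) * (ennreal \<mu> * ennreal V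
        + ennreal (\<mu> powr (1 - p)) * ennreal (t powr (- n) * E))"
      by (intro mult_left_mono add_left_mono A) auto
    also have "\<dots> = ennreal (2 * \<rho> * (\<mu> * V + \<mu> powr (1 - p) * (t powr (- n) * E)))"
      using \<rho> \<mu> V0 E by (simp add: ennreal_mult' ennreal_plus)
    also have "2 * \<rho> * (\<mu> * V + \<mu> powr (1 - p) * (t powr (- n) * E)) = 4 * \<rho> * (l * V) * t powr (- \<beta>)"
    proof -
      have "\<mu> powr (1 - p) * (t powr (- n) * E)
          = (l powr (1 - p) * E) * ((t powr (- \<beta>)) powr (1 - p) * t powr (- n))"
        using l by (simp add: \<mu>_def powr_mult)
      also have "(t powr (- \<beta>)) powr (1 - p) * t powr (- n) = t powr (- \<beta>)"
        using t p1 unfolding powr_powr powr_add[symmetric] by (simp add: \<beta>_def field_simps)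
      finally show ?thesis unfolding lp \<mu>_def by (simp add: algebra_simps)
    qed
    also have "ennreal \<dots> = ennreal (4 * \<rho> * (l * V)) * (ennreal (t powr (- \<beta>)) * indicator {0..1} t)"
      using True \<rho> l V0 by (simp add: ennreal_mult')
    finally show ?thesis .
  qed simp
  have "(\<integral>\<^sup>+y\<in>Q. ennreal \<bar>f y - f x\<bar> \<partial>lborel) \<le> (\<integral>\<^sup>+y. (\<integral>\<^sup>+t.
      ennreal (2 * \<rho> * \<phi> (x + t *\<^sub>R (y - x))) * indicator {0..1} t * indicator Q y \<partial>lborel) \<partial>lborel)"
    by (intro nn_integral_mono path)
  also have "\<dots> = (\<integral>\<^sup>+t. (\<integral>\<^sup>+y.
      ennreal (2 * \<rho> * \<phi> (x + t *\<^sub>R (y - x))) * indicator {0..1} t * indicator Q y \<partial>lborel) \<partial>lborel)"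
    by (rule lborel_pair.Fubini') measurable
  also have "\<dots> \<le> (\<integral>\<^sup>+t. ennreal (4 * \<rho> * (l * V)) * (ennreal (t powr (- \<beta>)) * indicator {0..1} t) \<partial>lborel)"
    \<comment> \<open>At t = 0 the contraction collapses the ball to a point, so this null slice is
      left out.\<close>
    using AE_lborel_singleton[of 0] by (intro nn_integral_mono_AE) (auto elim!: eventually_mono intro: inner)
  also have "\<dots> = ennreal (4 * \<rho> * (l * V)) * ennreal (1 / (1 - \<beta>))"
    using \<beta> by (simp add: nn_integral_cmult nn_integral_powr_unit_interval)
  also have "\<dots> = ennreal (V * (4 * \<rho> / (1 - \<beta>) * l))"
    using \<rho> l V0 \<beta> by (simp add: ennreal_mult'[symmetric] field_simps)
  finally show ?thesis unfolding Q_def \<beta>_def n_def l_def by simp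
qed

text \<open>The 8 is twice the 4 of the one-point estimate, which in turn comes from the diameter
  2\<rho> and the two balanced terms; the volume factor comes from V^(-1/p).\<close>

definition morrey_const :: "real \<Rightarrow> real \<Rightarrow> real" where
  "morrey_const n p = 8 / (1 - n / p) * unit_ball_vol n powr (- (1 / p))"

lemma measure_cball_powr:
  assumes "\<rho> > 0" "p > 0"
  shows "measure lborel (cball (c::'a::euclidean_space) \<rho>) powr (- (1 / p))
    = unit_ball_vol (DIM('a)) powr (- (1 / p)) * \<rho> powr (- (DIM('a) / p))"
proof -
  have "(\<rho> ^ DIM('a)) powr (- (1 / p)) = \<rho> powr (- (DIM('a) / p))"
    using assms by (simp add: powr_realpow[symmetric] powr_powr)
  then show ?thesis using assms by (simp add: content_cball powr_mult)
qed

text \<open>Both f x and f y are compared with f w, averaged over w in the ball. \<open>E\<close> is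
  an upper bound for the energy, and its positivity keeps the level \<open>l\<close>
  positive.\<close>

lemma morrey_cball:
  fixes f :: "'a::euclidean_space \<Rightarrow> real"
  assumes p: "p > real DIM('a)" and \<rho>: "\<rho> > 0" and xy: "x \<in> cball c \<rho>" "y \<in> cball c \<rho>"
    and cont: "continuous_on (cball c \<rho>) G"
    and der: "\<And>v. v \<in> cball c \<rho> \<Longrightarrow> (f has_derivative (\<lambda>h. G v \<bullet> h)) (at v within cball c \<rho>)"
    and E: "E > 0" and int: "(\<integral>\<^sup>+v\<in>cball c \<rho>. ennreal (norm (G v) powr p) \<partial>lborel) \<le> ennreal E"
  shows "\<bar>f x - f y\<bar> \<le> morrey_const (DIM('a)) p * \<rho> powr (1 - DIM('a) / p) * E powr (1 / p)"
proof -
  define V where "V = measure lborel (cball c \<rho>)"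
  define k where "k = 4 * \<rho> / (1 - DIM('a) / p) * (E / V) powr (1 / p)"
  have p1: "p > 1" using p DIM_positive[where 'a='a] by linarith
  have V0: "V > 0" unfolding V_def using \<rho> content_cball_pos[of \<rho> c] by simp
  have k: "k \<ge> 0" using \<rho> p p1 by (simp add: k_def)
  have fc: "continuous_on (cball c \<rho>) f"
    by (rule has_derivative_continuous_on[OF der])
  have fm: "(\<lambda>w. ennreal \<bar>f w - f v\<bar> * indicator (cball c \<rho>) w) \<in> borel_measurable lborel" for v
  proof -
    have "(\<lambda>w. indicator (cball c \<rho>) w *\<^sub>R \<bar>f w - f v\<bar>) \<in> borel_measurable borel"
      by (intro borel_measurable_continuous_on_indicator continuous_intros fc) auto
    then have "(\<lambda>w. ennreal (indicator (cball c \<rho>) w *\<^sub>R \<bar>f w - f v\<bar>)) \<in> borel_measurable lborel"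
      by simp
    then show ?thesis by (simp add: ennreal_mult' ennreal_indicator mult.commute)
  qed
  have "ennreal (\<bar>f x - f y\<bar> * V) = (\<integral>\<^sup>+w\<in>cball c \<rho>. ennreal \<bar>f x - f y\<bar> \<partial>lborel)"
    using emeasure_bounded_finite[OF bounded_cball, of c \<rho>]
    by (simp add: nn_integral_cmult_indicator V_def ennreal_mult' emeasure_eq_ennreal_measure)
  also have "\<dots> \<le> (\<integral>\<^sup>+w. ennreal \<bar>f w - f x\<bar> * indicator (cball c \<rho>) w
        + ennreal \<bar>f w - f y\<bar> * indicator (cball c \<rho>) w \<partial>lborel)"
    by (intro nn_integral_mono)
       (auto simp: indicator_def ennreal_plus[symmetric] simp del: ennreal_plus intro!: ennreal_leI)
  also have "\<dots> = (\<integral>\<^sup>+w\<in>cball c \<rho>. ennreal \<bar>f w - f x\<bar> \<partial>lborel) + (\<integral>\<^sup>+w\<in>cball c \<rho>. ennreal \<bar>f w - f y\<bar> \<partial>lborel)"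
    by (rule nn_integral_add[OF fm fm])
  also have "\<dots> \<le> ennreal (V * k) + ennreal (V * k)"
    unfolding k_def
    by (intro add_mono nn_integral_diff_cball_le[OF p \<rho> _ cont der E int V_def] xy)
  also have "\<dots> = ennreal (2 * k * V)"
    using V0 k by (simp add: ennreal_plus[symmetric] algebra_simps del: ennreal_plus)
  finally have "\<bar>f x - f y\<bar> * V \<le> 2 * k * V"
    using k V0 by (simp add: ennreal_le_iff)
  then have "\<bar>f x - f y\<bar> \<le> 2 * k" using V0 by simp
  also have "2 * k = 8 / (1 - DIM('a) / p) * \<rho> * (E powr (1 / p) * V powr (- (1 / p)))"
    using E V0 by (simp add: k_def powr_divide powr_minus_divide)
  also have "V powr (- (1 / p)) = unit_ball_vol (DIM('a)) powr (- (1 / p)) * \<rho> powr (- (DIM('a) / p))"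
    unfolding V_def using \<rho> p1 by (intro measure_cball_powr) auto
  also have "8 / (1 - DIM('a) / p) * \<rho> * (E powr (1 / p) * (unit_ball_vol (DIM('a)) powr (- (1 / p)) * \<rho> powr (- (DIM('a) / p))))
      = morrey_const (DIM('a)) p * \<rho> powr (1 - DIM('a) / p) * E powr (1 / p)"
    using \<rho> by (simp add: morrey_const_def powr_diff powr_minus_divide)
  finally show ?thesis .
qed

section \<open>The improved Hardy inequality\<close>

lemma infdist_compl_ball:
  fixes x z :: "'a::{real_normed_vector, perfect_space}"
  assumes "x \<in> ball z R"
  shows "infdist x (- ball z R) = R - norm (x - z)"
proof (rule antisym)
  have R: "R > 0" "norm (x - z) < R" using assms
    by (auto simp: dist_norm norm_minus_commute intro: le_less_trans[OF norm_ge_zero])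
  obtain y where y: "norm (y - z) = R" "norm (x - y) = R - norm (x - z)"
  proof (cases "x = z")
    case True
    obtain v :: 'a where "norm v = R" using vector_choose_size[of R] R by auto
    with that[of "z + v"] True show ?thesis by simp
  next
    case False
    have "x - (z + R *\<^sub>R sgn (x - z)) = (norm (x - z) - R) *\<^sub>R sgn (x - z)"
      using False by (simp add: sgn_div_norm scaleR_diff_left left_diff_distrib)
    then show ?thesis using that[of "z + R *\<^sub>R sgn (x - z)"] False R by (simp add: norm_sgn)
  qed
  then show "infdist x (- ball z R) \<le> R - norm (x - z)"
    using infdist_le[of y "- ball z R" x] by (simp add: dist_norm norm_minus_commute)
  have "R - norm (x - z) \<le> dist x a" if "a \<in> - ball z R" for a
    using that dist_triangle[of z a x] by (simp add: dist_norm norm_minus_commute)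
  moreover have "y \<in> - ball z R" using y(1) by (simp add: dist_norm norm_minus_commute)
  ultimately show "R - norm (x - z) \<le> infdist x (- ball z R)"
    unfolding infdist_def by (auto intro!: cINF_greatest)
qed

text \<open>Since p > 1, the derivative exists at 0 too and vanishes there, in agreement with
  \<open>sgn 0 = 0\<close>; zeros of u then need no separate treatment.\<close>

lemma has_real_derivative_abs_powr:
  fixes s p :: real
  assumes "p > 1"
  shows "((\<lambda>s. \<bar>s\<bar> powr p) has_real_derivative p * \<bar>s\<bar> powr (p - 1) * sgn s) (at s)"
proof (cases "s = 0")
  case True
  have "(\<lambda>h. \<bar>h\<bar> powr (p - 1) * sgn h) \<midarrow>0\<rightarrow> 0"
  proof (rule Lim_null_comparison)
    show "\<forall>\<^sub>F h in at 0. norm (\<bar>h\<bar> powr (p - 1) * sgn h) \<le> \<bar>h\<bar> powr (p - 1)"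
      by (auto simp: abs_mult sgn_if)
    have "((\<lambda>h::real. \<bar>h\<bar> powr (p - 1)) \<longlongrightarrow> \<bar>0\<bar> powr (p - 1)) (at 0)"
      using assms by (intro tendsto_powr' tendsto_intros) auto
    then show "((\<lambda>h::real. \<bar>h\<bar> powr (p - 1)) \<longlongrightarrow> 0) (at 0)" by simp
  qed
  moreover have "\<bar>h\<bar> powr p / h = \<bar>h\<bar> powr (p - 1) * sgn h" for h :: real
    by (cases "h = 0") (auto simp: powr_diff sgn_if)
  ultimately show ?thesis using True by (simp add: DERIV_def)
next
  case False
  have "((\<lambda>s. \<bar>s\<bar>) has_real_derivative sgn s) (at s)"
    using has_derivative_norm[OF False]
    by (simp add: has_field_derivative_def real_norm_def[abs_def] mult_commute_abs)
  from DERIV_powr[OF this, of "\<lambda>_. p" 0] False show ?thesis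
    by (simp add: powr_diff algebra_simps)
qed

lemma has_derivative_radial_powr:
  fixes x z :: "'a::real_inner"
  assumes "x \<noteq> z" "norm (x - z) < R"
  shows "((\<lambda>x. (R - norm (x - z)) powr c) has_derivative
    (\<lambda>h. ((- c * (R - norm (x - z)) powr (c - 1)) *\<^sub>R sgn (x - z)) \<bullet> h)) (at x)"
proof -
  have "((\<lambda>s. s powr c) has_real_derivative c * (R - norm (x - z)) powr (c - 1)) (at (R - norm (x - z)))"
    using assms by (auto intro!: derivative_eq_intros)
  moreover have "((\<lambda>x. R - norm (x - z)) has_derivative (\<lambda>h. - (h \<bullet> sgn (x - z)))) (at x)"
    using assms by (auto intro!: derivative_eq_intros has_derivative_compose[OF _ has_derivative_norm])
  ultimately have "((\<lambda>x. (R - norm (x - z)) powr c) has_derivative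
      (\<lambda>h. - (h \<bullet> sgn (x - z)) * (c * (R - norm (x - z)) powr (c - 1)))) (at x)"
    by (rule DERIV_compose_FDERIV)
  then show ?thesis by (rule has_derivative_eq_rhs) (simp add: fun_eq_iff inner_commute)
qed

lemma continuous_on_zero_extension:
  fixes f :: "'a::topological_space \<Rightarrow> 'b::real_normed_vector"
  assumes "open B" "closed S" "S \<subseteq> B" "continuous_on B f" "\<And>x. x \<notin> S \<Longrightarrow> f x = 0"
  shows "continuous_on UNIV f"
proof -
  have "continuous_on (- S) f"
    by (rule continuous_on_eq[of _ "\<lambda>_. 0"]) (use assms in auto)
  then have "continuous_on (B \<union> - S) f"
    using assms by (intro continuous_on_open_Un) (auto simp: open_Compl)
  moreover have "B \<union> - S = UNIV" using assms by auto
  ultimately show ?thesis by simp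
qed

lemma bounded_compact_support:
  fixes f :: "'a::topological_space \<Rightarrow> real"
  assumes "continuous_on UNIV f" "compact S" "\<And>x. x \<notin> S \<Longrightarrow> f x = 0"
  obtains M where "\<And>x. \<bar>f x\<bar> \<le> M"
proof -
  have "bounded (f ` S)"
    using assms by (intro compact_imp_bounded compact_continuous_image) (auto intro: continuous_on_subset)
  then obtain M where "\<forall>y\<in>f ` S. norm y \<le> M" by (auto simp: bounded_iff)
  then have "\<bar>f x\<bar> \<le> max M 0" for x using assms(3)[of x] by (cases "x \<in> S") auto
  then show ?thesis by (rule that)
qed

lemma smooth_has_derivative:
  fixes f :: "real ^ 'n::finite \<Rightarrow> real"
  assumes "smooth f"
  shows "(f has_derivative (\<lambda>h. grad f x \<bullet> h)) (at x)"
proof -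
  have "continuously_diff 1 f" using assms by (simp add: smooth_def)
  then have D: "(f has_derivative frechet_derivative f (at x)) (at x)"
    by (simp add: frechet_derivative_works[symmetric])
  interpret L: linear "frechet_derivative f (at x)" using D by (rule has_derivative_linear)
  have "frechet_derivative f (at x) h = grad f x \<bullet> h" for h
  proof -
    have "frechet_derivative f (at x) h = frechet_derivative f (at x) (\<Sum>i\<in>UNIV. h $ i *\<^sub>R axis i 1)"
      using basis_expansion[of h] by (simp add: scalar_mult_eq_scaleR)
    also have "\<dots> = (\<Sum>i\<in>UNIV. h $ i * pderiv_dir i f x)"
      by (simp add: L.sum L.scale pderiv_dir_def)
    also have "\<dots> = grad f x \<bullet> h"
      by (simp add: inner_vec_def grad_def mult.commute)
    finally show ?thesis .
  qed
  then have "frechet_derivative f (at x) = (\<lambda>h. grad f x \<bullet> h)" by auto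
  with D show ?thesis by simp
qed

lemma smooth_continuous_grad:
  fixes f :: "real ^ 'n::finite \<Rightarrow> real"
  assumes "smooth f"
  shows "continuous_on A (grad f)"
proof -
  have "continuously_diff (Suc 0) f" using assms unfolding smooth_def by blast
  then have "continuous_on A (pderiv_dir i f)" for i
    by (auto intro: continuous_on_subset)
  then show ?thesis unfolding grad_def[abs_def] by (intro continuous_intros)
qed

text \<open>The sum of the reciprocals of the two coefficients in \<open>hardy_improved\<close>, so
  one multiple of the Hardy difference dominates both integrals there.\<close>

definition hardy_const :: "real \<Rightarrow> real" where
  "hardy_const p = 2 powr (p - 1) + (1 - 1 / p) powr (1 - p)"

section \<open>The Hardy difference of one test function\<close>

locale ball_test_function =
  fixes p R :: real and z :: "real ^ 'n::finite" and u :: "real ^ 'n \<Rightarrow> real"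
  assumes dim: "CARD('n) \<ge> 2" and p: "p > real CARD('n)" and R: "R > 0"
    and u: "u \<in> test_functions (ball z R)"
begin

definition S where "S = closure {x. u x \<noteq> 0}"

text \<open>The explicit formula for the distance inside the ball, differentiable off
  \<open>z\<close>. Outside the ball it is nonpositive, but there u and its gradient vanish.\<close>

definition d where "d x = R - norm (x - z)"

definition \<theta> where "\<theta> = 1 - 1 / p"

text \<open>With $u = d^\theta v$ the gradient splits as
  $\nabla u = \theta\, d^{-1/p} v\, \nabla d + d^\theta \nabla v$; this is the second summand.\<close>
definition b where "b x = grad u x + (\<theta> * u x / d x) *\<^sub>R sgn (x - z)"

text \<open>Inside the ball this is |v|^p for u = d^\<theta> v, because p \<theta> = p - 1.\<close>

definition w where "w x = \<bar>u x\<bar> powr p * d x powr (1 - p)"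

lemma p2: "p > 2" using dim p by linarith

lemma \<theta>: "0 < \<theta>" "\<theta> < 1" "p * \<theta> = p - 1"
  using p2 by (auto simp: \<theta>_def field_simps)

lemma hardy_const_eq: "hardy_const p = 2 powr (p - 1) + \<theta> powr (1 - p)"
  by (simp add: hardy_const_def \<theta>_def)

lemma hardy_const_pos: "hardy_const p > 0"
  using \<theta> by (simp add: hardy_const_eq add_pos_pos)

lemma S: "compact S" "closed S" "S \<subseteq> ball z R" "x \<notin> S \<Longrightarrow> u x = 0"
  using u closure_subset[of "{x. u x \<noteq> 0}"] by (auto simp: test_functions_def S_def)

lemma smooth_u: "smooth u" using u by (simp add: test_functions_def)

lemmas u_der = smooth_has_derivative[OF smooth_u]
lemmas grad_cont = smooth_continuous_grad[OF smooth_u]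

lemma u_cont: "continuous_on A u"
  using u_der has_derivative_continuous continuous_at_imp_continuous_on by blast

lemma grad_zero: assumes "x \<notin> S" shows "grad u x = 0"
proof -
  have "(u has_derivative (\<lambda>h. 0)) (at x)"
    by (rule has_derivative_transform_within_open[of "\<lambda>_. 0" _ _ _ "- S"])
       (use S assms in \<open>auto simp: open_Compl\<close>)
  then have "(\<lambda>h. grad u x \<bullet> h) = (\<lambda>h. 0)"
    using u_der has_derivative_unique by blast
  then show ?thesis by (metis inner_eq_zero_iff)
qed

lemma in_ball: "x \<in> ball z R \<longleftrightarrow> d x > 0"
  by (auto simp: d_def dist_norm norm_minus_commute)

lemma dist_compl_eq: "x \<in> ball z R \<Longrightarrow> dist_compl (ball z R) x = d x"
  by (simp add: dist_compl_def infdist_compl_ball d_def)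

lemma d_cont: "continuous_on A d"
  unfolding d_def[abs_def] by (intro continuous_intros)

lemma w_nonneg: "w x \<ge> 0" by (simp add: w_def)

text \<open>Negative powers of \<open>d\<close> blow up at the sphere, but \<open>S\<close> is a
  compact subset of the open ball. A product with a factor that vanishes off \<open>S\<close> is
  therefore harmless.\<close>

lemma cutoff:
  assumes "continuous_on (ball z R) f" "\<And>x. x \<notin> S \<Longrightarrow> f x = (0::real)"
  shows "continuous_on UNIV f" "integrable lborel f" "\<exists>M. \<forall>x. \<bar>f x\<bar> \<le> M"
proof -
  show c: "continuous_on UNIV f"
    by (rule continuous_on_zero_extension[OF _ S(2,3) assms]) auto
  show "integrable lborel f"
    by (rule integrable_compact_support[OF c S(1) assms(2)])
  show "\<exists>M. \<forall>x. \<bar>f x\<bar> \<le> M"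
    by (rule bounded_compact_support[OF c S(1) assms(2)]) auto
qed

lemma d_powr_cont: "continuous_on (ball z R) (\<lambda>x. d x powr c)"
  by (intro continuous_on_powr d_cont continuous_intros) (auto simp: in_ball simp del: mem_ball)

lemma abs_powr_cont: "c > 0 \<Longrightarrow> continuous_on A (\<lambda>x. \<bar>u x\<bar> powr c)"
  by (intro continuous_on_powr' u_cont continuous_intros) auto

lemma w_cutoff: "continuous_on UNIV w" "integrable lborel w"
  using p2 unfolding w_def[abs_def]
  by (intro cutoff continuous_intros d_powr_cont abs_powr_cont; simp add: S)+

text \<open>The gradient of \<open>w\<close> away from \<open>z\<close>. At \<open>z\<close> the
  convention \<open>sgn 0 = 0\<close> gives it some value, which keeps it a total Borel
  function.\<close>

definition W where
  "W x = (p * \<bar>u x\<bar> powr (p - 1) * sgn (u x) * d x powr (1 - p)) *\<^sub>R grad u x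
       + ((p - 1) * \<bar>u x\<bar> powr p * d x powr (- p)) *\<^sub>R sgn (x - z)"

lemma w_der:
  assumes "x \<noteq> z"
  shows "(w has_derivative (\<lambda>h. W x \<bullet> h)) (at x)"
proof (cases "x \<in> ball z R")
  case True
  have "((\<lambda>x. \<bar>u x\<bar> powr p) has_derivative
      (\<lambda>h. (grad u x \<bullet> h) * (p * \<bar>u x\<bar> powr (p - 1) * sgn (u x)))) (at x)"
    using p2 by (intro DERIV_compose_FDERIV[OF has_real_derivative_abs_powr u_der]) auto
  moreover have "((\<lambda>x. d x powr (1 - p)) has_derivative
      (\<lambda>h. ((- (1 - p) * d x powr (1 - p - 1)) *\<^sub>R sgn (x - z)) \<bullet> h)) (at x)"
    unfolding d_def by (intro has_derivative_radial_powr assms) (use True in \<open>simp add: dist_norm norm_minus_commute\<close>)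
  ultimately have "(w has_derivative (\<lambda>h. \<bar>u x\<bar> powr p * (((- (1 - p) * d x powr (1 - p - 1)) *\<^sub>R sgn (x - z)) \<bullet> h)
      + (grad u x \<bullet> h) * (p * \<bar>u x\<bar> powr (p - 1) * sgn (u x)) * d x powr (1 - p))) (at x)"
    unfolding w_def[abs_def] by (rule has_derivative_mult)
  then show ?thesis
    by (rule has_derivative_eq_rhs) (simp add: fun_eq_iff W_def inner_add_left algebra_simps)
next
  case False
  then have x: "x \<notin> S" using S by blast
  have "(w has_derivative (\<lambda>h. 0)) (at x)"
    by (rule has_derivative_transform_within_open[of "\<lambda>_. 0" _ _ _ "- S"])
       (use S x in \<open>auto simp: open_Compl w_def\<close>)
  moreover have "W x = 0" using x S(4) by (simp add: W_def grad_zero)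
  ultimately show ?thesis by simp
qed

lemma W_meas: "W \<in> borel_measurable borel"
proof -
  have [measurable]: "u \<in> borel_measurable borel" "grad u \<in> borel_measurable borel" "d \<in> borel_measurable borel"
    by (intro borel_measurable_continuous_onI u_cont grad_cont d_cont)+
  show ?thesis unfolding W_def[abs_def] by measurable
qed

lemma W_bound: "\<exists>L. \<forall>x. norm (W x) \<le> L"
proof -
  \<comment> \<open>\<open>W\<close> can jump at \<open>z\<close> through \<open>sgn\<close>;
    \<open>k\<close> is a continuous majorant of its norm, to which \<open>cutoff\<close>
    applies.\<close>
  define k where "k x = (p * \<bar>u x\<bar> powr (p - 1) * d x powr (1 - p)) * norm (grad u x)
       + (p - 1) * \<bar>u x\<bar> powr p * d x powr (- p)" for x
  have "\<exists>M. \<forall>x. \<bar>k x\<bar> \<le> M"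
  proof (rule cutoff)
    show "continuous_on (ball z R) k"
      unfolding k_def[abs_def] using p2
      by (intro continuous_on_add continuous_on_mult continuous_on_const continuous_on_norm
          d_powr_cont abs_powr_cont grad_cont) auto
  qed (simp add: k_def S grad_zero)
  moreover have "norm (W x) \<le> \<bar>k x\<bar>" for x
  proof -
    have "norm (W x) \<le> norm ((p * \<bar>u x\<bar> powr (p - 1) * sgn (u x) * d x powr (1 - p)) *\<^sub>R grad u x)
       + norm (((p - 1) * \<bar>u x\<bar> powr p * d x powr (- p)) *\<^sub>R sgn (x - z))"
      unfolding W_def by (rule norm_triangle_ineq)
    also have "\<dots> \<le> k x" unfolding k_def using p2
      by (intro add_mono) (auto simp: abs_mult norm_sgn sgn_if)
    finally show ?thesis by simp
  qed
  ultimately show ?thesis by (meson order_trans)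
qed

text \<open>Expand |a + b|^p with a = -(\<theta> u / d) e for the radial unit vector e: |a|^p is
  exactly the Hardy density, and the linear term is a pure radial derivative, ready to be
  integrated.\<close>

lemma hardy_pointwise:
  assumes "x \<noteq> z"
  shows "2 powr (1 - p) * norm (b x) powr p - \<theta> powr (p - 1) * (W x \<bullet> sgn (x - z))
    \<le> norm (grad u x) powr p - \<theta> powr p * (\<bar>u x\<bar> powr p / d x powr p)"
proof (cases "x \<in> ball z R")
  case True
  then have d: "d x > 0" by (simp only: in_ball)
  define e where "e = sgn (x - z)"
  have e: "norm e = 1" "e \<bullet> e = 1" using assms by (auto simp: e_def norm_sgn dot_square_norm)
  define a where "a = - (\<theta> * u x / d x) *\<^sub>R e"
  define g where "g = grad u x \<bullet> e"
  have na: "norm a = \<theta> * \<bar>u x\<bar> / d x" using \<theta> d e by (simp add: a_def abs_mult)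
  have g: "grad u x = a + b x" by (simp add: a_def b_def e_def)
  have We: "W x \<bullet> e = p * \<bar>u x\<bar> powr (p - 1) * sgn (u x) * d x powr (1 - p) * g
      + (p - 1) * \<bar>u x\<bar> powr p * d x powr (- p)"
    using e by (simp add: W_def inner_add_left e_def[symmetric] g_def)
  have nap: "norm a powr p = \<theta> powr p * (\<bar>u x\<bar> powr p / d x powr p)"
    unfolding na using \<theta> d by (simp add: powr_mult powr_divide)
  \<comment> \<open>Both summands of the radial component of \<open>W\<close> appear with the right
    coefficients precisely because p \<theta> = p - 1.\<close>
  have "p * norm a powr (p - 2) * (a \<bullet> b x) = - (\<theta> powr (p - 1)) * (W x \<bullet> e)"
  proof (cases "u x = 0")
    case False
    have ab: "a \<bullet> b x = - (\<theta> * u x / d x) * (g + \<theta> * u x / d x)"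
      using e d by (simp add: a_def b_def e_def[symmetric] inner_add_right g_def inner_commute field_simps)
    have "norm a powr (p - 2) = \<theta> powr (p - 2) * (\<bar>u x\<bar> powr (p - 2)) / d x powr (p - 2)"
      unfolding na using \<theta> d by (simp add: powr_mult powr_divide)
    then have "p * norm a powr (p - 2) * (a \<bullet> b x)
       = - ((p * \<theta> powr (p - 2) * \<bar>u x\<bar> powr (p - 2) / d x powr (p - 2)) * ((\<theta> * u x / d x) * g))
         - (p * \<theta>) * (\<theta> powr (p - 2) * \<theta>) * ((\<bar>u x\<bar> powr (p - 2) * (u x)\<^sup>2) / (d x powr (p - 2) * (d x)\<^sup>2))"
      unfolding ab using d by (simp add: field_simps power2_eq_square)
    also have "\<bar>u x\<bar> powr (p - 2) * (u x)\<^sup>2 = \<bar>u x\<bar> powr p"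
      using False by (simp add: powr_diff powr_numeral)
    also have "d x powr (p - 2) * (d x)\<^sup>2 = d x powr p"
      using d by (simp add: powr_diff powr_numeral)
    also have "\<theta> powr (p - 2) * \<theta> = \<theta> powr (p - 1)"
      using \<theta> by (simp add: powr_diff power2_eq_square)
    also have "(p * \<theta> powr (p - 2) * \<bar>u x\<bar> powr (p - 2) / d x powr (p - 2)) * ((\<theta> * u x / d x) * g)
        = \<theta> powr (p - 1) * (p * \<bar>u x\<bar> powr (p - 1) * sgn (u x) * d x powr (1 - p) * g)"
      using \<theta> d False
      by (simp add: powr_diff power2_eq_square sgn_if field_simps abs_if split: if_splits)
    finally show ?thesis unfolding We \<theta>(3) using d
      by (simp add: powr_minus field_simps)
  qed (simp add: a_def W_def)
  moreover have "norm a powr p + p * norm a powr (p - 2) * (a \<bullet> b x) + 2 powr (1 - p) * norm (b x) powr p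
      \<le> norm (grad u x) powr p"
    unfolding g using p2 by (intro norm_powr_add_ge_remainder) simp
  ultimately show ?thesis unfolding nap e_def by simp
next
  case False
  then have "x \<notin> S" using S by blast
  then show ?thesis using S by (simp add: b_def W_def grad_zero)
qed

lemma u_over_d_cont: "continuous_on (ball z R) (\<lambda>x. \<theta> * u x / d x)"
  by (intro continuous_intros u_cont d_cont) (auto simp: in_ball simp del: mem_ball)

lemma b_meas: "b \<in> borel_measurable borel"
proof -
  have [measurable]: "u \<in> borel_measurable borel" "grad u \<in> borel_measurable borel" "d \<in> borel_measurable borel"
    by (intro borel_measurable_continuous_onI u_cont grad_cont d_cont)+
  show ?thesis unfolding b_def[abs_def] by measurable
qed

text \<open>\<open>b\<close> may jump at \<open>z\<close>, so integrability is taken from a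
  continuous compactly supported majorant.\<close>

lemma b_int: "integrable lborel (\<lambda>x. norm (b x) powr p)"
proof (rule Bochner_Integration.integrable_bound)
  show "integrable lborel (\<lambda>x. (norm (grad u x) + \<bar>\<theta> * u x / d x\<bar>) powr p)"
    using p2 by (intro cutoff continuous_on_powr' continuous_intros grad_cont u_over_d_cont)
      (auto simp: S grad_zero)
  show "(\<lambda>x. norm (b x) powr p) \<in> borel_measurable lborel"
    using b_meas by measurable
  show "AE x in lborel. norm (norm (b x) powr p) \<le> norm ((norm (grad u x) + \<bar>\<theta> * u x / d x\<bar>) powr p)"
  proof (intro AE_I2)
    fix x
    have "norm (b x) \<le> norm (grad u x) + norm ((\<theta> * u x / d x) *\<^sub>R sgn (x - z))"
      unfolding b_def by (rule norm_triangle_ineq)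
    also have "\<dots> \<le> norm (grad u x) + \<bar>\<theta> * u x / d x\<bar>" by (simp add: norm_sgn)
    finally show "norm (norm (b x) powr p) \<le> norm ((norm (grad u x) + \<bar>\<theta> * u x / d x\<bar>) powr p)"
      using p2 by (auto intro: powr_mono2)
  qed
qed

text \<open>The radial derivative of \<open>w\<close> enters \<open>hardy_pointwise\<close> with a
  minus sign, and its integral is at most -(1/R) times the integral of \<open>w\<close>; the cross
  term thus becomes a gain.\<close>

lemma hardy_improved:
  "2 powr (1 - p) * (\<integral>x. norm (b x) powr p \<partial>lborel) + \<theta> powr (p - 1) * ((1 / R) * (\<integral>x. w x \<partial>lborel))
    \<le> hardy_difference p (ball z R) u"
proof -
  obtain L where L: "\<And>x. norm (W x) \<le> L" using W_bound by blast
  have w0: "w x = 0" if "norm (x - z) \<ge> R" for x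
  proof -
    have "x \<notin> S" using S(3) that by (auto simp: dist_norm norm_minus_commute)
    then show ?thesis by (simp add: w_def S)
  qed
  have rad: "integrable lborel (\<lambda>x. W x \<bullet> sgn (x - z))"
    "(\<integral>x. W x \<bullet> sgn (x - z) \<partial>lborel) \<le> - (1 / R) * (\<integral>x. w x \<partial>lborel)"
    by (rule integral_radial_derivative_le[of R w z W L]; use dim R w_cutoff w_nonneg w0 w_der L W_meas in simp)+
  have gi: "integrable lborel (\<lambda>x. norm (grad u x) powr p)"
    using p2 by (intro cutoff continuous_on_powr' continuous_intros grad_cont) (auto simp: grad_zero)
  have ui: "integrable lborel (\<lambda>x. \<bar>u x\<bar> powr p / d x powr p)"
    using p2 by (intro cutoff continuous_intros abs_powr_cont d_powr_cont)
      (auto simp: S in_ball simp del: mem_ball)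
  have out: "x \<notin> ball z R \<Longrightarrow> x \<notin> S" for x using S by blast
  have "(LINT x:ball z R|lborel. norm (grad u x) powr p) = (\<integral>x. norm (grad u x) powr p \<partial>lborel)"
    unfolding set_lebesgue_integral_def
    by (rule Bochner_Integration.integral_cong) (auto simp: indicator_def grad_zero[OF out])
  moreover have "(LINT x:ball z R|lborel. \<bar>u x\<bar> powr p / dist_compl (ball z R) x powr p)
      = (\<integral>x. \<bar>u x\<bar> powr p / d x powr p \<partial>lborel)"
    unfolding set_lebesgue_integral_def
    by (rule Bochner_Integration.integral_cong) (auto simp: indicator_def dist_compl_eq S(4)[OF out])
  moreover have "(p - 1) / p = \<theta>" using p2 by (simp add: \<theta>_def field_simps)
  ultimately have H: "hardy_difference p (ball z R) u
      = (\<integral>x. norm (grad u x) powr p - \<theta> powr p * (\<bar>u x\<bar> powr p / d x powr p) \<partial>lborel)"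
    using gi ui by (simp add: hardy_difference_def del: times_divide_eq_right)
  have "(\<integral>x. 2 powr (1 - p) * norm (b x) powr p - \<theta> powr (p - 1) * (W x \<bullet> sgn (x - z)) \<partial>lborel)
      \<le> hardy_difference p (ball z R) u"
    unfolding H
  proof (rule integral_mono_AE)
    show "AE x in lborel. 2 powr (1 - p) * norm (b x) powr p - \<theta> powr (p - 1) * (W x \<bullet> sgn (x - z))
        \<le> norm (grad u x) powr p - \<theta> powr p * (\<bar>u x\<bar> powr p / d x powr p)"
      using AE_lborel_singleton[of z] by eventually_elim (rule hardy_pointwise)
  qed (intro Bochner_Integration.integrable_diff integrable_mult_right b_int rad(1) gi ui)+
  also have "(\<integral>x. 2 powr (1 - p) * norm (b x) powr p - \<theta> powr (p - 1) * (W x \<bullet> sgn (x - z)) \<partial>lborel)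
      = 2 powr (1 - p) * (\<integral>x. norm (b x) powr p \<partial>lborel) - \<theta> powr (p - 1) * (\<integral>x. W x \<bullet> sgn (x - z) \<partial>lborel)"
    using b_int rad(1) by simp
  moreover have "\<theta> powr (p - 1) * (\<integral>x. W x \<bullet> sgn (x - z) \<partial>lborel) \<le> \<theta> powr (p - 1) * (- (1 / R) * (\<integral>x. w x \<partial>lborel))"
    by (intro mult_left_mono rad(2)) simp
  ultimately show ?thesis by simp
qed

lemma hardy_difference_nonneg: "hardy_difference p (ball z R) u \<ge> 0"
proof -
  have "0 \<le> 2 powr (1 - p) * (\<integral>x. norm (b x) powr p \<partial>lborel) + \<theta> powr (p - 1) * ((1 / R) * (\<integral>x. w x \<partial>lborel))"
    using R w_nonneg by (intro add_nonneg_nonneg mult_nonneg_nonneg integral_nonneg_AE) auto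
  then show ?thesis using hardy_improved by linarith
qed

text \<open>Both summands in \<open>hardy_improved\<close> are nonnegative, so each is separately at
  most the Hardy difference, and \<open>hardy_const\<close> absorbs its coefficient.\<close>

lemma
  assumes "hardy_const p * hardy_difference p (ball z R) u \<le> E"
  shows b_le: "(\<integral>\<^sup>+x. ennreal (norm (b x) powr p) \<partial>lborel) \<le> ennreal E"
    and w_le: "(\<integral>\<^sup>+x. ennreal (w x) \<partial>lborel) \<le> ennreal (R * E)"
proof -
  define H where "H = hardy_difference p (ball z R) u"
  define B where "B = (\<integral>x. norm (b x) powr p \<partial>lborel)"
  define I where "I = (\<integral>x. w x \<partial>lborel)"
  have B: "B \<ge> 0" and I: "I \<ge> 0"
    using w_nonneg by (auto simp: B_def I_def intro!: integral_nonneg_AE)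
  have 1: "2 powr (1 - p) * B + \<theta> powr (p - 1) * ((1 / R) * I) \<le> H"
    using hardy_improved by (simp add: B_def I_def H_def)
  have 2: "2 powr (1 - p) * B \<ge> 0" "\<theta> powr (p - 1) * ((1 / R) * I) \<ge> 0"
    using B I R by auto
  have H: "H \<ge> 0" unfolding H_def by (rule hardy_difference_nonneg)
  have E: "2 powr (p - 1) * H \<le> E" "\<theta> powr (1 - p) * H \<le> E"
  proof -
    have "(2 powr (p - 1) + \<theta> powr (1 - p)) * H \<le> E" using assms by (simp add: hardy_const_eq H_def)
    moreover have "2 powr (p - 1) * H \<ge> 0" "\<theta> powr (1 - p) * H \<ge> 0" using H by auto
    ultimately show "2 powr (p - 1) * H \<le> E" "\<theta> powr (1 - p) * H \<le> E" by (auto simp: distrib_right)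
  qed
  have "B = 2 powr (p - 1) * (2 powr (1 - p) * B)" by (simp add: powr_diff)
  also have "\<dots> \<le> 2 powr (p - 1) * H" using 1 2 by (intro mult_left_mono) auto
  finally have "B \<le> E" using E by linarith
  have "I = R * (\<theta> powr (1 - p) * (\<theta> powr (p - 1) * ((1 / R) * I)))" using R \<theta> by (simp add: powr_diff)
  also have "\<dots> \<le> R * (\<theta> powr (1 - p) * H)" using 1 2 R by (intro mult_left_mono) auto
  also have "\<dots> \<le> R * E" using E R by (intro mult_left_mono) auto
  finally have "I \<le> R * E" .
  show "(\<integral>\<^sup>+x. ennreal (norm (b x) powr p) \<partial>lborel) \<le> ennreal E"
    using \<open>B \<le> E\<close> by (subst nn_integral_eq_integral[OF b_int]) (auto simp: B_def intro: ennreal_leI)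
  show "(\<integral>\<^sup>+x. ennreal (w x) \<partial>lborel) \<le> ennreal (R * E)"
    using \<open>I \<le> R * E\<close> w_nonneg
    by (subst nn_integral_eq_integral[OF w_cutoff(2)]) (auto simp: I_def intro: ennreal_leI)
qed

end

section \<open>Pointwise and Hoelder estimates\<close>

text \<open>The first summand is Morrey's oscillation bound on the ball of radius 3R/4, the second
  the bound by the mean of \<open>w\<close> there, both with R and E split off.\<close>

definition interior_const :: "real \<Rightarrow> real \<Rightarrow> real" where
  "interior_const n p = morrey_const n p * (3/4) powr (1 - n / p) * (2 powr p * 5) powr (1 / p)
     + unit_ball_vol n powr (- (1 / p)) * (3/4) powr (- (n / p))"

text \<open>The first summand serves depth at least R/4. The second is the solution m/(1 - q) of s =
  q s + m, with q the contraction factor of \<open>chain_step\<close>.\<close>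

definition pointwise_const :: "real \<Rightarrow> real \<Rightarrow> real" where
  "pointwise_const n p = interior_const n p * 4 powr (1 - n / p)
     + morrey_const n p / (1 - 2 powr (1 / p - n / p))"

text \<open>The summands serve pairs of points that are far apart and close together, relative to
  their depth.\<close>

definition hoelder_const :: "real \<Rightarrow> real \<Rightarrow> real" where
  "hoelder_const n p = 2 * pointwise_const n p * 2 powr (1 - n / p)
     + morrey_const n p * (2 powr p * (1 + pointwise_const n p powr p * unit_ball_vol n)) powr (1 / p)"

section \<open>Bounds for the normalised size of u and the Hoelder estimate\<close>

context ball_test_function
begin

definition n :: real where "n = real CARD('n)"

definition \<beta> where "\<beta> = n / p"

lemma \<beta>: "0 < \<beta>" "\<beta> < 1" "1 / p < \<beta>" "n \<ge> 2"
  using p2 p dim by (auto simp: \<beta>_def n_def divide_strict_right_mono)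

lemma morrey_const_pos: "morrey_const n p > 0"
  using \<beta> by (simp add: morrey_const_def \<beta>_def[symmetric] unit_ball_vol_pos less_imp_neq[OF unit_ball_vol_pos, symmetric])

lemma interior_const_pos: "interior_const n p > 0"
  using morrey_const_pos by (auto simp: interior_const_def intro!: add_pos_nonneg mult_pos_pos)

lemma pointwise_const_pos: "pointwise_const n p > 0"
proof -
  have "2 powr (1 / p - \<beta>) < 1" using \<beta> by (simp add: powr_less_one)
  then show ?thesis using interior_const_pos morrey_const_pos
    by (auto simp: pointwise_const_def \<beta>_def[symmetric] intro!: add_pos_nonneg mult_pos_pos)
qed

lemma hoelder_const_pos: "hoelder_const n p > 0"
  using pointwise_const_pos morrey_const_pos unit_ball_vol_pos[of n] \<beta>
  by (auto simp: hoelder_const_def intro!: add_pos_nonneg mult_pos_pos)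

text \<open>The size of u relative to the growth d^(1-n/p) that the Hoelder bound predicts; bounding
  it by E^(1/p) is the pointwise estimate.\<close>

definition N where "N x = \<bar>u x\<bar> * d x powr (\<beta> - 1)"

lemma N_nonneg: "N x \<ge> 0" by (simp add: N_def)

lemma u_eq_N: "d x > 0 \<Longrightarrow> \<bar>u x\<bar> = N x * d x powr (1 - \<beta>)"
  by (simp add: N_def powr_diff)

lemma d_lipschitz: "d x \<le> d y + norm (x - y)"
  using norm_triangle_ineq2[of "y - z" "x - z"] by (simp add: d_def norm_minus_commute)

lemma d_le_R: "d x \<le> R" by (simp add: d_def)

lemmas morrey = morrey_cball[where 'a = "real ^ 'n", simplified DIM_cart DIM_real mult_1_right, OF p, folded n_def, folded \<beta>_def]

text \<open>The Hardy difference may vanish, whereas \<open>morrey_cball\<close> asks for a positive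
  energy bound. A positive \<open>E\<close> therefore stands in for it, and
  \<open>hoelder_estimate\<close> removes it at the end.\<close>

context
  fixes E :: real
  assumes E: "E > 0" and HE: "hardy_const p * hardy_difference p (ball z R) u \<le> E"
begin

text \<open>Since grad u differs from \<open>b\<close> by a vector of length at most |u/d|, any
  bound on u/d yields an energy bound for u itself and opens the way to Morrey's inequality for
  u.\<close>

lemma grad_int:
  assumes A: "A \<in> sets borel" and F: "F \<ge> 0"
    "(\<integral>\<^sup>+x\<in>A. ennreal (\<bar>u x / d x\<bar> powr p) \<partial>lborel) \<le> ennreal F"
  shows "(\<integral>\<^sup>+x\<in>A. ennreal (norm (grad u x) powr p) \<partial>lborel) \<le> ennreal (2 powr p * (E + F))"
proof -
  have [measurable]: "u \<in> borel_measurable borel" "d \<in> borel_measurable borel" "b \<in> borel_measurable borel"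
    by (intro borel_measurable_continuous_onI u_cont d_cont b_meas)+
  note A[measurable]
  have pw: "norm (grad u x) powr p \<le> 2 powr p * (norm (b x) powr p + \<bar>u x / d x\<bar> powr p)" for x
  proof -
    have "norm (grad u x) = norm (b x - (\<theta> * u x / d x) *\<^sub>R sgn (x - z))" by (simp add: b_def)
    also have "\<dots> \<le> norm (b x) + \<theta> * \<bar>u x / d x\<bar>"
      by (rule order_trans[OF norm_triangle_ineq4]) (use \<theta> in \<open>simp add: norm_sgn abs_mult\<close>)
    also have "\<dots> \<le> norm (b x) + \<bar>u x / d x\<bar>"
      using \<theta> by (intro add_left_mono mult_left_le_one_le) auto
    finally have "norm (grad u x) powr p \<le> (norm (b x) + \<bar>u x / d x\<bar>) powr p"
      using p2 by (intro powr_mono2) auto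
    also have "\<dots> = 2 powr p * ((norm (b x) + \<bar>u x / d x\<bar>) / 2) powr p"
      by (simp add: powr_divide)
    also have "\<dots> \<le> 2 powr p * ((norm (b x) powr p + \<bar>u x / d x\<bar> powr p) / 2)"
      using p2 by (intro mult_left_mono powr_midpoint_le) auto
    also have "\<dots> \<le> 2 powr p * (norm (b x) powr p + \<bar>u x / d x\<bar> powr p)"
      by (intro mult_left_mono) auto
    finally show ?thesis .
  qed
  have "(\<integral>\<^sup>+x\<in>A. ennreal (norm (grad u x) powr p) \<partial>lborel)
      \<le> (\<integral>\<^sup>+x. ennreal (2 powr p) * (ennreal (norm (b x) powr p)
          + ennreal (\<bar>u x / d x\<bar> powr p) * indicator A x) \<partial>lborel)"
  proof (rule nn_integral_mono)
    fix x
    show "ennreal (norm (grad u x) powr p) * indicator A x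
      \<le> ennreal (2 powr p) * (ennreal (norm (b x) powr p) + ennreal (\<bar>u x / d x\<bar> powr p) * indicator A x)"
    proof (cases "x \<in> A")
      case True
      then show ?thesis using ennreal_leI[OF pw[of x]] by (simp add: ennreal_mult' ennreal_plus)
    qed simp
  qed
  also have "\<dots> = ennreal (2 powr p) * ((\<integral>\<^sup>+x. ennreal (norm (b x) powr p) \<partial>lborel)
      + (\<integral>\<^sup>+x\<in>A. ennreal (\<bar>u x / d x\<bar> powr p) \<partial>lborel))"
    by (simp add: nn_integral_cmult nn_integral_add)
  also have "\<dots> \<le> ennreal (2 powr p) * (ennreal E + ennreal F)"
    by (intro mult_left_mono add_mono b_le[OF HE] F) simp
  also have "\<dots> = ennreal (2 powr p * (E + F))"
    using E F by (simp add: ennreal_mult' ennreal_plus)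
  finally show ?thesis .
qed

text \<open>Away from the sphere \<open>d\<close> is comparable to R, so the integral of
  \<open>w\<close> bounds both |u/d|^p and |u|^p. The former limits the oscillation of u, the latter
  its mean size.\<close>

lemma interior_bound:
  assumes x: "d x \<ge> R / 4"
  shows "N x \<le> interior_const n p * 4 powr (1 - \<beta>) * E powr (1 / p)"
proof -
  define e where "e = E powr (1 / p)"
  \<comment> \<open>The ball of this radius is exactly the region of depth at least R/4.\<close>
  define \<rho> where "\<rho> = 3 / 4 * R"
  define Q where "Q = cball z \<rho>"
  define k where "k = morrey_const n p * \<rho> powr (1 - \<beta>) * (2 powr p * 5 * E) powr (1 / p)"
  define V where "V = measure lborel Q"
  \<comment> \<open>By the oscillation bound |u| is at least \<open>m\<close> on all of
    \<open>Q\<close>, so a positive \<open>m\<close> is controlled by the integral of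
    \<open>w\<close>.\<close>
  define m where "m = \<bar>u x\<bar> - k"
  have \<rho>: "\<rho> > 0" using R by (simp add: \<rho>_def)
  have V0: "V > 0" unfolding V_def Q_def using \<rho> content_cball_pos[of \<rho> z] by simp
  have dQ: "d y \<ge> R / 4" if "y \<in> Q" for y
    using that by (simp add: Q_def \<rho>_def d_def dist_norm norm_minus_commute)
  have xQ: "x \<in> Q" using x by (simp add: Q_def \<rho>_def d_def dist_norm norm_minus_commute)
  have up: "\<bar>u y\<bar> powr p = w y * d y powr (p - 1)" if "y \<in> Q" for y
    using dQ[OF that] R by (simp add: w_def powr_diff)
  have wQ: "(\<integral>\<^sup>+y. ennreal c * ennreal (w y) \<partial>lborel) \<le> ennreal (c * (R * E))" if "c \<ge> 0" for c
  proof -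
    have "(\<integral>\<^sup>+y. ennreal c * ennreal (w y) \<partial>lborel) = ennreal c * (\<integral>\<^sup>+y. ennreal (w y) \<partial>lborel)"
      using w_cutoff(1)[THEN borel_measurable_continuous_onI] by (intro nn_integral_cmult) measurable
    also have "\<dots> \<le> ennreal c * ennreal (R * E)" by (intro mult_left_mono w_le[OF HE]) simp
    finally show ?thesis using that by (simp add: ennreal_mult')
  qed
  \<comment> \<open>On \<open>Q\<close> the integrand is w/d, at most (4/R) w, with integral at most
    4E; adding the E from \<open>b\<close> gives the 5 in \<open>interior_const\<close>.\<close>
  have "(\<integral>\<^sup>+y\<in>Q. ennreal (\<bar>u y / d y\<bar> powr p) \<partial>lborel) \<le> (\<integral>\<^sup>+y. ennreal (4 / R) * ennreal (w y) \<partial>lborel)"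
  proof (rule nn_integral_mono)
    fix y
    show "ennreal (\<bar>u y / d y\<bar> powr p) * indicator Q y \<le> ennreal (4 / R) * ennreal (w y)"
    proof (cases "y \<in> Q")
      case True
      have d: "d y \<ge> R / 4" "d y > 0" using dQ[OF True] R by auto
      have "\<bar>u y / d y\<bar> powr p = (1 / d y) * w y"
        using d up[OF True] by (simp add: powr_divide powr_diff)
      also have "\<dots> \<le> (4 / R) * w y"
        using d R w_nonneg by (intro mult_right_mono) (auto simp: field_simps)
      finally show ?thesis using True R by (simp add: ennreal_mult'[symmetric] ennreal_leI)
    qed simp
  qed
  also have "\<dots> \<le> ennreal (4 * E)" using wQ[of "4 / R"] R by simp
  finally have "(\<integral>\<^sup>+y\<in>Q. ennreal (norm (grad u y) powr p) \<partial>lborel) \<le> ennreal (2 powr p * (E + 4 * E))"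
    using E by (intro grad_int) (auto simp: Q_def)
  then have gQ: "(\<integral>\<^sup>+y\<in>Q. ennreal (norm (grad u y) powr p) \<partial>lborel) \<le> ennreal (2 powr p * 5 * E)"
    by (simp add: algebra_simps)
  have osc: "\<bar>u x - u y\<bar> \<le> k" if "y \<in> Q" for y
    unfolding k_def
    by (rule morrey[of \<rho> x z y "grad u"])
       (use \<rho> xQ that gQ E grad_cont u_der[THEN has_derivative_at_withinI] in \<open>auto simp: Q_def\<close>)
  have m: "m \<le> R * e * V powr (- (1 / p))"
  proof (cases "m > 0")
    case True
    have "ennreal (m powr p * V) = (\<integral>\<^sup>+y. ennreal (m powr p) * indicator Q y \<partial>lborel)"
      using emeasure_bounded_finite[OF bounded_cball, of z \<rho>]
      by (simp add: Q_def nn_integral_cmult_indicator V_def ennreal_mult' emeasure_eq_ennreal_measure)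
    also have "\<dots> \<le> (\<integral>\<^sup>+y. ennreal (R powr (p - 1)) * ennreal (w y) \<partial>lborel)"
    proof (rule nn_integral_mono)
      fix y
      show "ennreal (m powr p) * indicator Q y \<le> ennreal (R powr (p - 1)) * ennreal (w y)"
      proof (cases "y \<in> Q")
        case yQ: True
        have "m powr p \<le> \<bar>u y\<bar> powr p" using osc[OF yQ] True p2 by (intro powr_mono2) (auto simp: m_def)
        also have "\<dots> \<le> R powr (p - 1) * w y"
          unfolding up[OF yQ] using w_nonneg dQ[OF yQ] d_le_R[of y] R p2
          by (subst mult.commute, intro mult_right_mono powr_mono2) auto
        finally show ?thesis using yQ by (simp add: ennreal_mult'[symmetric] ennreal_leI)
      qed simp
    qed
    also have "\<dots> \<le> ennreal (R powr (p - 1) * (R * E))" by (rule wQ) simp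
    also have "R powr (p - 1) * (R * E) = R powr p * E" using R by (simp add: powr_diff)
    finally have "m powr p * V \<le> R powr p * E" using E by (simp add: ennreal_le_iff)
    then have "m powr p \<le> R powr p * E / V" using V0 by (simp add: field_simps)
    then have "(m powr p) powr (1 / p) \<le> (R powr p * E / V) powr (1 / p)"
      using p2 by (intro powr_mono2) auto
    then show ?thesis using True R E V0 p2
      by (simp add: powr_powr powr_mult powr_divide e_def powr_minus_divide)
  next
    case False
    then have "m \<le> 0" by simp
    also have "0 \<le> R * e * V powr (- (1 / p))" using R by (simp add: e_def)
    finally show ?thesis .
  qed
  have \<rho>\<beta>: "\<rho> powr c = (3/4) powr c * R powr c" for c by (simp only: \<rho>_def powr_mult)
  have Vp: "V powr (- (1 / p)) = unit_ball_vol n powr (- (1 / p)) * (3/4) powr (- \<beta>) * R powr (- \<beta>)"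
    using measure_cball_powr[OF \<rho>, of p z] p2 by (simp add: V_def Q_def n_def[symmetric] \<beta>_def[symmetric] \<rho>\<beta>)
  have "(2 powr p * 5 * E) powr (1 / p) = (2 powr p * 5) powr (1 / p) * e"
    by (simp add: e_def powr_mult)
  then have kp: "k = morrey_const n p * (3/4) powr (1 - \<beta>) * (2 powr p * 5) powr (1 / p) * (R powr (1 - \<beta>) * e)"
    by (simp add: k_def \<rho>\<beta>)
  have R1: "R powr (1 - \<beta>) = R * R powr (- \<beta>)" using R by (simp add: powr_diff powr_minus_divide)
  have mp: "R * e * V powr (- (1 / p)) = unit_ball_vol n powr (- (1 / p)) * (3/4) powr (- \<beta>) * (R powr (1 - \<beta>) * e)"
    unfolding Vp R1 by (simp only: mult_ac)
  have "\<bar>u x\<bar> \<le> interior_const n p * (R powr (1 - \<beta>) * e)"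
    using m unfolding m_def mp kp interior_const_def \<beta>_def[symmetric] by (simp only: distrib_right)
  moreover have "d x powr (\<beta> - 1) \<le> (R / 4) powr (\<beta> - 1)"
    using x R \<beta> by (intro powr_mono2') auto
  ultimately have "N x \<le> interior_const n p * (R powr (1 - \<beta>) * e) * (R / 4) powr (\<beta> - 1)"
    unfolding N_def by (intro mult_mono) auto
  also have "\<dots> = interior_const n p * 4 powr (1 - \<beta>) * e"
    using R by (simp add: powr_diff powr_divide field_simps)
  finally show ?thesis by (simp add: e_def)
qed

text \<open>The witness $x'$ is twice as far from the boundary as $x$. As the factor in front of $N(x')$ is below $1$,
  at a maximum point of $N$ this bounds $N$ itself.\<close>
lemma chain_step:
  assumes "0 < d x" "d x < R / 4"
  obtains x' where "N x \<le> 2 powr (1 / p - \<beta>) * N x' + morrey_const n p * E powr (1 / p)"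
proof -
  define \<delta> where "\<delta> = d x"
  define r where "r = norm (x - z)"
  have \<delta>: "0 < \<delta>" "\<delta> < R / 4" and r: "r = R - \<delta>" "r > 0"
    using assms by (auto simp: \<delta>_def r_def d_def)
  \<comment> \<open>Moving inwards by \<delta> doubles the depth. The ball of radius \<delta> about
    x' keeps depth at least \<delta> and avoids \<open>z\<close>, since |x' - z| = R - 2\<delta> >
    \<delta>.\<close>
  define x' where "x' = x - \<delta> *\<^sub>R sgn (x - z)"
  have "r *\<^sub>R sgn (x - z) = x - z" using r(2) by (simp add: r_def sgn_div_norm)
  then have "x' - z = (r - \<delta>) *\<^sub>R sgn (x - z)"
    by (simp add: x'_def scaleR_diff_left)
  moreover have "x \<noteq> z" using r(2) by (auto simp: r_def)
  ultimately have x'z: "norm (x' - z) = R - 2 * \<delta>"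
    using r \<delta> by (simp add: norm_sgn)
  have xx': "norm (x' - x) = \<delta>" using r \<delta> by (auto simp: x'_def norm_sgn r_def)
  define Q where "Q = cball x' \<delta>"
  have Q: "\<delta> \<le> d y \<and> y \<noteq> z" if "y \<in> Q" for y
  proof -
    have "norm (x' - y) \<le> \<delta>" using that by (simp add: Q_def dist_norm)
    moreover have "d x' = 2 * \<delta>" by (simp add: d_def x'z)
    ultimately show ?thesis using d_lipschitz[of x' y] x'z \<delta> by (auto simp: norm_minus_commute)
  qed
  \<comment> \<open>In the gradient of v the radial correction in \<open>b\<close> is exactly what
    differentiating d^(-\<theta>) produces, so \<open>G\<close> is d^(-\<theta>)
    \<open>b\<close>.\<close>
  define v where "v y = u y * d y powr (- \<theta>)" for y
  define G where "G y = d y powr (- \<theta>) *\<^sub>R b y" for y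
  have "\<bar>v x - v x'\<bar> \<le> morrey_const n p * \<delta> powr (1 - \<beta>) * (\<delta> powr (1 - p) * E) powr (1 / p)"
  proof (rule morrey)
    show "x \<in> cball x' \<delta>" "x' \<in> cball x' \<delta>" using \<delta> xx' by (auto simp: dist_norm)
    show "continuous_on (cball x' \<delta>) G"
      unfolding G_def b_def Q_def[symmetric]
      by (intro continuous_intros continuous_on_powr grad_cont u_cont d_cont continuous_on_sgn)
         (use Q \<delta> in force)+
    show "(v has_derivative (\<lambda>h. G y \<bullet> h)) (at y within cball x' \<delta>)" if "y \<in> cball x' \<delta>" for y
    proof -
      have y: "\<delta> \<le> d y" "y \<noteq> z" using Q[of y] that by (auto simp: Q_def)
      have "((\<lambda>x. d x powr (- \<theta>)) has_derivative
          (\<lambda>h. ((- (- \<theta>) * d y powr (- \<theta> - 1)) *\<^sub>R sgn (y - z)) \<bullet> h)) (at y)"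
        unfolding d_def by (intro has_derivative_radial_powr y) (use y \<delta> in \<open>simp add: d_def\<close>)
      then have "(v has_derivative (\<lambda>h. u y * (((- (- \<theta>) * d y powr (- \<theta> - 1)) *\<^sub>R sgn (y - z)) \<bullet> h)
          + (grad u y \<bullet> h) * d y powr (- \<theta>))) (at y)"
        unfolding v_def[abs_def] by (intro has_derivative_mult u_der)
      then have "(v has_derivative (\<lambda>h. G y \<bullet> h)) (at y)"
        by (rule has_derivative_eq_rhs)
           (use y \<delta> in \<open>simp add: fun_eq_iff G_def b_def inner_add_left powr_diff field_simps\<close>)
      then show ?thesis by (rule has_derivative_at_withinI)
    qed
    show "(\<integral>\<^sup>+y\<in>cball x' \<delta>. ennreal (norm (G y) powr p) \<partial>lborel) \<le> ennreal (\<delta> powr (1 - p) * E)"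
    proof -
      have "(\<integral>\<^sup>+y\<in>Q. ennreal (norm (G y) powr p) \<partial>lborel)
          \<le> (\<integral>\<^sup>+y. ennreal (\<delta> powr (1 - p)) * ennreal (norm (b y) powr p) \<partial>lborel)"
      proof (rule nn_integral_mono)
        fix y
        show "ennreal (norm (G y) powr p) * indicator Q y \<le> ennreal (\<delta> powr (1 - p)) * ennreal (norm (b y) powr p)"
        proof (cases "y \<in> Q")
          case True
          have "norm (G y) powr p = d y powr (- (p * \<theta>)) * norm (b y) powr p"
            by (simp add: G_def powr_mult powr_powr mult.commute)
          also have "\<dots> \<le> \<delta> powr (1 - p) * norm (b y) powr p"
            unfolding \<theta>(3) minus_diff_eq using Q[OF True] \<delta> p2 by (intro mult_right_mono powr_mono2') auto
          finally show ?thesis using True by (simp add: ennreal_mult'[symmetric] ennreal_leI)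
        qed simp
      qed
      also have "\<dots> = ennreal (\<delta> powr (1 - p)) * (\<integral>\<^sup>+y. ennreal (norm (b y) powr p) \<partial>lborel)"
        using b_meas by (intro nn_integral_cmult) measurable
      also have "\<dots> \<le> ennreal (\<delta> powr (1 - p)) * ennreal E"
        by (intro mult_left_mono b_le[OF HE]) simp
      finally show ?thesis by (simp add: Q_def ennreal_mult')
    qed
  qed (use \<delta> E in auto)
  also have "(\<delta> powr (1 - p) * E) powr (1 / p) = \<delta> powr (- \<theta>) * E powr (1 / p)"
  proof -
    have "(1 - p) * (1 / p) = - \<theta>" using p2 by (simp add: \<theta>_def field_simps)
    then show ?thesis by (simp add: powr_mult powr_powr)
  qed
  finally have "\<bar>v x - v x'\<bar> \<le> morrey_const n p * \<delta> powr (1 - \<beta>) * (\<delta> powr (- \<theta>) * E powr (1 / p))" .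
  \<comment> \<open>The power of \<delta> is chosen to turn |v x| into \<open>N x\<close>; it also
    cancels every \<delta> in the error, so each step of the chain costs the same.\<close>
  then have "\<bar>v x - v x'\<bar> * \<delta> powr (\<beta> - 1 / p)
      \<le> morrey_const n p * \<delta> powr (1 - \<beta>) * (\<delta> powr (- \<theta>) * E powr (1 / p)) * \<delta> powr (\<beta> - 1 / p)"
    by (intro mult_right_mono) auto
  also have "\<dots> = morrey_const n p * E powr (1 / p) * (\<delta> powr (1 - \<beta>) * \<delta> powr (- \<theta>) * \<delta> powr (\<beta> - 1 / p))"
    by simp
  also have "\<delta> powr (1 - \<beta>) * \<delta> powr (- \<theta>) * \<delta> powr (\<beta> - 1 / p) = 1"
    unfolding powr_add[symmetric] using \<delta> by (simp add: \<theta>_def)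
  finally have 1: "\<bar>v x - v x'\<bar> * \<delta> powr (\<beta> - 1 / p) \<le> morrey_const n p * E powr (1 / p)" by simp
  have 2: "\<bar>v x\<bar> * \<delta> powr (\<beta> - 1 / p) = N x"
  proof -
    have "\<delta> powr (- \<theta>) * \<delta> powr (\<beta> - 1 / p) = \<delta> powr (\<beta> - 1)"
      unfolding powr_add[symmetric] by (simp add: \<theta>_def)
    then show ?thesis by (simp add: v_def N_def abs_mult \<delta>_def[symmetric])
  qed
  \<comment> \<open>The contraction factor appears because \<open>N x'\<close> is normalised at
    depth 2\<delta> instead of \<delta>; its exponent 1/p - \<beta> is -(n-1)/p.\<close>
  have 3: "\<bar>v x'\<bar> * \<delta> powr (\<beta> - 1 / p) = 2 powr (1 / p - \<beta>) * N x'"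
  proof -
    have dx': "d x' = 2 * \<delta>" by (simp add: d_def x'z)
    have "2 powr (1 / p - \<beta>) * (2 * \<delta>) powr (\<beta> - 1) = (2 powr (1 / p - \<beta>) * 2 powr (\<beta> - 1)) * \<delta> powr (\<beta> - 1)"
      by (simp add: powr_mult)
    also have "2 powr (1 / p - \<beta>) * 2 powr (\<beta> - 1) = (2::real) powr (- \<theta>)"
      unfolding powr_add[symmetric] by (simp add: \<theta>_def)
    also have "\<delta> powr (\<beta> - 1) = \<delta> powr (- \<theta>) * \<delta> powr (\<beta> - 1 / p)"
      unfolding powr_add[symmetric] by (simp add: \<theta>_def)
    finally show ?thesis by (simp add: v_def N_def abs_mult dx' powr_mult)
  qed
  have "N x \<le> (\<bar>v x'\<bar> + \<bar>v x - v x'\<bar>) * \<delta> powr (\<beta> - 1 / p)"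
    unfolding 2[symmetric] by (intro mult_right_mono) auto
  then show ?thesis using 1 3 by (intro that[of x']) (simp add: distrib_right)
qed

text \<open>\<open>N\<close> is continuous and vanishes off the compact set \<open>S\<close>, so it
  has a maximum point y. Near the sphere \<open>chain_step\<close> at y has N x' \<le> N y on its
  right-hand side and can be solved for N y.\<close>

lemma pointwise_bound: "N x \<le> pointwise_const n p * E powr (1 / p)"
proof (cases "S = {}")
  case True
  then show ?thesis using S(4) pointwise_const_pos by (simp add: N_def)
next
  case False
  have "continuous_on UNIV N"
    unfolding N_def[abs_def]
    by (intro cutoff continuous_intros u_cont d_powr_cont) (simp add: S)
  then obtain y where y: "y \<in> S" "\<And>x. x \<in> S \<Longrightarrow> N x \<le> N y"
    using continuous_attains_sup[OF S(1) False, of N] continuous_on_subset by blast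
  have max: "N x \<le> N y" for x
    using y(2)[of x] S(4)[of x] N_nonneg[of y] by (cases "x \<in> S") (auto simp: N_def)
  have dy: "d y > 0" using y(1) S(3) in_ball by blast
  define q where "q = 2 powr (1 / p - \<beta>)"
  have q: "0 < q" "q < 1" using \<beta> by (auto simp: q_def powr_less_one)
  have "interior_const n p * 4 powr (1 - \<beta>) \<le> pointwise_const n p"
    "morrey_const n p / (1 - q) \<le> pointwise_const n p"
    using interior_const_pos morrey_const_pos q
    by (auto simp: pointwise_const_def \<beta>_def[symmetric] q_def[symmetric])
  then have le: "interior_const n p * 4 powr (1 - \<beta>) * E powr (1 / p) \<le> pointwise_const n p * E powr (1 / p)"
    "morrey_const n p / (1 - q) * E powr (1 / p) \<le> pointwise_const n p * E powr (1 / p)"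
    by (auto intro!: mult_right_mono simp del: times_divide_eq_left)
  have "N y \<le> pointwise_const n p * E powr (1 / p)"
  proof (cases "d y \<ge> R / 4")
    case True
    then show ?thesis using interior_bound le by force
  next
    case False
    with dy obtain x' where "N y \<le> q * N x' + morrey_const n p * E powr (1 / p)"
      using chain_step[of y] unfolding q_def by force
    moreover have "q * N x' \<le> q * N y" using max q by (intro mult_left_mono) auto
    ultimately have "N y * (1 - q) \<le> morrey_const n p * E powr (1 / p)" by (simp add: algebra_simps)
    then have "N y \<le> morrey_const n p / (1 - q) * E powr (1 / p)" using q by (simp add: field_simps)
    then show ?thesis using le by linarith
  qed
  then show ?thesis using max[of x] by linarith
qed

text \<open>The distance of the points is compared with the larger depth d x: if it is at least d x
  / 2, the pointwise bound suffices; otherwise that bound supplies the energy for Morrey's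
  inequality on a ball about x.\<close>

lemma hoelder_bound_aux:
  assumes x: "x \<in> ball z R" and y: "y \<in> ball z R" and xy: "x \<noteq> y" and le: "d y \<le> d x"
  shows "\<bar>u x - u y\<bar> \<le> hoelder_const n p * norm (x - y) powr (1 - \<beta>) * E powr (1 / p)"
proof -
  define e where "e = E powr (1 / p)"
  define r where "r = norm (x - y)"
  define A where "A = pointwise_const n p"
  define K where "K = 2 powr p * (1 + A powr p * unit_ball_vol n)"
  have r: "r > 0" using xy by (simp add: r_def)
  have d: "0 < d y" "0 < d x" using x y by (auto simp only: in_ball)
  have A: "A > 0" unfolding A_def by (rule pointwise_const_pos)
  have NA: "N v \<le> A * e" for v unfolding A_def e_def by (rule pointwise_bound)
  have K: "K > 0" using unit_ball_vol_nonneg[of n] \<beta> by (auto simp: K_def intro!: mult_pos_pos add_pos_nonneg)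
  have hc: "hoelder_const n p = 2 * A * 2 powr (1 - \<beta>) + morrey_const n p * K powr (1 / p)"
    by (simp add: hoelder_const_def A_def K_def \<beta>_def)
  have pos: "0 \<le> A * 2 powr (1 - \<beta>) * r powr (1 - \<beta>) * e" "0 \<le> morrey_const n p * K powr (1 / p) * r powr (1 - \<beta>) * e"
    using A morrey_const_pos by (auto simp: e_def)
  have "\<bar>u x - u y\<bar> \<le> (2 * A * 2 powr (1 - \<beta>) + morrey_const n p * K powr (1 / p)) * r powr (1 - \<beta>) * e"
  proof (cases "r \<ge> d x / 2")
    case True
    \<comment> \<open>Both depths are at most 2r here, so the two values of u are bounded
      separately.\<close>
    have *: "\<bar>u v\<bar> \<le> A * 2 powr (1 - \<beta>) * r powr (1 - \<beta>) * e" if "d v > 0" "d v \<le> 2 * r" for v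
    proof -
      have "\<bar>u v\<bar> = N v * d v powr (1 - \<beta>)" by (rule u_eq_N[OF that(1)])
      also have "\<dots> \<le> (A * e) * (2 * r) powr (1 - \<beta>)"
        using that \<beta> A by (intro mult_mono NA powr_mono2) (auto simp: e_def)
      finally show ?thesis by (simp add: powr_mult mult_ac)
    qed
    have "\<bar>u x - u y\<bar> \<le> \<bar>u x\<bar> + \<bar>u y\<bar>" by simp
    also have "\<dots> \<le> 2 * (A * 2 powr (1 - \<beta>) * r powr (1 - \<beta>) * e)"
      using *[of x] *[of y] d True le by simp
    finally show ?thesis using pos by (simp add: distrib_right algebra_simps)
  next
    case False
    \<comment> \<open>Now d x > 2r, which leaves depth at least r on all of
      \<open>Q\<close>.\<close>
    define Q where "Q = cball x r"
    have dQ: "r \<le> d v" if "v \<in> Q" for v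
      using that d_lipschitz[of x v] False by (simp add: Q_def dist_norm)
    have "(\<integral>\<^sup>+v\<in>Q. ennreal (\<bar>u v / d v\<bar> powr p) \<partial>lborel)
        \<le> (\<integral>\<^sup>+v. ennreal (A powr p * E * r powr (- n)) * indicator Q v \<partial>lborel)"
    proof (rule nn_integral_mono)
      fix v
      show "ennreal (\<bar>u v / d v\<bar> powr p) * indicator Q v \<le> ennreal (A powr p * E * r powr (- n)) * indicator Q v"
      proof (cases "v \<in> Q")
        case True
        have dv: "r \<le> d v" "d v > 0" using dQ[OF True] r by auto
        \<comment> \<open>The p-th power of the resulting bound carries r^(-n), which the volume of
          \<open>Q\<close> cancels; the energy bound is independent of r.\<close>
        have "\<bar>u v / d v\<bar> = N v * d v powr (- \<beta>)"
          using dv u_eq_N[OF dv(2)] by (simp add: powr_diff powr_minus_divide)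
        also have "\<dots> \<le> (A * e) * r powr (- \<beta>)"
          using dv r \<beta> A by (intro mult_mono NA powr_mono2') (auto simp: e_def)
        finally have "\<bar>u v / d v\<bar> powr p \<le> ((A * e) * r powr (- \<beta>)) powr p"
          using p2 by (intro powr_mono2) auto
        also have "\<dots> = A powr p * E * r powr (- n)"
          using p2 E by (simp add: powr_mult powr_powr e_def \<beta>_def)
        finally show ?thesis using True by (simp add: ennreal_leI)
      qed simp
    qed
    also have "\<dots> = ennreal (A powr p * E * r powr (- n) * measure lborel Q)"
      using emeasure_bounded_finite[OF bounded_cball, of x r] E
      by (simp add: Q_def nn_integral_cmult_indicator ennreal_mult' emeasure_eq_ennreal_measure)
    also have "measure lborel Q = unit_ball_vol n * r powr n"
      using r by (simp add: Q_def content_cball n_def powr_realpow)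
    also have "A powr p * E * r powr (- n) * (unit_ball_vol n * r powr n) = A powr p * unit_ball_vol n * E"
      using r by (simp add: powr_minus_divide)
    finally have "(\<integral>\<^sup>+v\<in>Q. ennreal (norm (grad u v) powr p) \<partial>lborel)
        \<le> ennreal (2 powr p * (E + A powr p * unit_ball_vol n * E))"
      using E \<beta> by (intro grad_int) (auto simp: Q_def)
    also have "2 powr p * (E + A powr p * unit_ball_vol n * E) = K * E"
      by (simp add: K_def algebra_simps)
    finally have gQ: "(\<integral>\<^sup>+v\<in>Q. ennreal (norm (grad u v) powr p) \<partial>lborel) \<le> ennreal (K * E)" .
    have "\<bar>u x - u y\<bar> \<le> morrey_const n p * r powr (1 - \<beta>) * (K * E) powr (1 / p)"
      by (rule morrey[of r x x y "grad u"])
         (use r gQ E K grad_cont u_der[THEN has_derivative_at_withinI] in \<open>auto simp: Q_def r_def dist_norm\<close>)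
    also have "\<dots> = morrey_const n p * K powr (1 / p) * r powr (1 - \<beta>) * e"
      by (simp add: e_def powr_mult)
    finally show ?thesis using pos by (simp add: distrib_right)
  qed
  then show ?thesis by (simp add: hc r_def e_def)
qed

lemma hoelder_bound:
  assumes "x \<in> ball z R" "y \<in> ball z R" "x \<noteq> y"
  shows "\<bar>u x - u y\<bar> \<le> hoelder_const n p * norm (x - y) powr (1 - \<beta>) * E powr (1 / p)"
  using hoelder_bound_aux[of x y] hoelder_bound_aux[of y x] assms
  by (cases "d y \<le> d x") (auto simp: norm_minus_commute abs_minus_commute)

end

lemma hoelder_estimate:
  assumes "x \<in> ball z R" "y \<in> ball z R" "x \<noteq> y"
  shows "\<bar>u x - u y\<bar> \<le> hoelder_const n p * hardy_const p powr (1 / p) * norm (x - y) powr (1 - n / p)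
    * hardy_difference p (ball z R) u powr (1 / p)"
proof (cases "hardy_difference p (ball z R) u = 0")
  case False
  then have H: "hardy_difference p (ball z R) u > 0" using hardy_difference_nonneg by simp
  with hoelder_bound[of "hardy_const p * hardy_difference p (ball z R) u", OF _ _ assms] hardy_const_pos
  show ?thesis by (simp add: powr_mult \<beta>_def mult_ac)
next
  case True
  \<comment> \<open>With vanishing Hardy difference every E > 0 is admissible, and letting E tend to
    0 forces u x = u y.\<close>
  define h where "h k = inverse (real (Suc k))" for k
  have "(\<lambda>k. hoelder_const n p * norm (x - y) powr (1 - \<beta>) * h k powr (1 / p))
      \<longlonglongrightarrow> hoelder_const n p * norm (x - y) powr (1 - \<beta>) * 0 powr (1 / p)"
    unfolding h_def using p2
    by (intro tendsto_mult tendsto_const tendsto_powr' LIMSEQ_inverse_real_of_nat) auto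
  then have "(\<lambda>k. hoelder_const n p * norm (x - y) powr (1 - \<beta>) * h k powr (1 / p)) \<longlonglongrightarrow> 0"
    by simp
  moreover have "\<bar>u x - u y\<bar> \<le> hoelder_const n p * norm (x - y) powr (1 - \<beta>) * h k powr (1 / p)" for k
    by (rule hoelder_bound[OF _ _ assms]) (auto simp: True h_def)
  ultimately have "\<bar>u x - u y\<bar> \<le> 0"
    by (intro LIMSEQ_le_const) auto
  then show ?thesis by (simp add: True)
qed

end

section \<open>The logarithmic factor and the final estimate\<close>

lemma X_bounds:
  assumes "0 < t" "t \<le> 1"
  shows "0 \<le> X t" "X t \<le> 1"
proof -
  have "ln t \<le> 0" using assms by simp
  then show "0 \<le> X t" "X t \<le> 1" unfolding X_def by (auto simp: inverse_le_1_iff)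
qed

theorem mainTheorem10:
  fixes p :: real
  assumes "CARD('n::finite) \<ge> 2" and "p > real CARD('n)"
  shows "\<exists>b c :: real. b \<ge> 1 \<and> c > 0 \<and>
    (\<forall>(z :: real ^ 'n) R. R > 0 \<longrightarrow>
      (\<forall>u \<in> test_functions (ball z R).
        (SUP (x, y) \<in> {(x, y). x \<in> ball z R \<and> y \<in> ball z R \<and> x \<noteq> y}.
           ereal (\<bar>u x - u y\<bar> / norm (x - y) powr (1 - real CARD('n) / p)
                  * X (norm (x - y) / (2 * b * R)) powr (1 / p)))
        \<le> ereal (c * hardy_difference p (ball z R) u powr (1 / p))))"
proof (intro exI conjI allI impI ballI)
  define c where "c = hoelder_const (real CARD('n)) p * hardy_const p powr (1 / p)"
  have "(\<lambda>_. 0) \<in> test_functions (ball (0 :: real ^ 'n) 1)"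
  proof -
    have "continuously_diff k (\<lambda>_ :: real ^ 'n. 0)" for k
    proof (induction k)
      case (Suc k)
      then show ?case by (simp add: pderiv_dir_def[abs_def])
    qed simp
    then show ?thesis by (simp add: test_functions_def smooth_def)
  qed
  \<comment> \<open>The constants do not depend on $z$, $R$, $u$, so their positivity can be read off a trivial instance.\<close>
  then interpret zero: ball_test_function p 1 "0 :: real ^ 'n" "\<lambda>_. 0"
    using assms by unfold_locales auto
  show "c > 0"
    using zero.hoelder_const_pos zero.hardy_const_pos by (simp add: c_def zero.n_def)
  fix z :: "real ^ 'n" and R :: real and u
  assume R: "R > 0" and u: "u \<in> test_functions (ball z R)"
  interpret ball_test_function p R z u by unfold_locales (use assms R u in auto)
  \<comment> \<open>Here b becomes 1: two points of the ball are less than 2R apart, so the argument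
    of \<open>X\<close> stays in (0, 1].\<close>
  show "(SUP (x, y) \<in> {(x, y). x \<in> ball z R \<and> y \<in> ball z R \<and> x \<noteq> y}.
           ereal (\<bar>u x - u y\<bar> / norm (x - y) powr (1 - real CARD('n) / p)
                  * X (norm (x - y) / (2 * 1 * R)) powr (1 / p)))
        \<le> ereal (c * hardy_difference p (ball z R) u powr (1 / p))"
  proof (rule SUP_least, clarify)
    fix x y assume x: "x \<in> ball z R" and y: "y \<in> ball z R" and xy: "x \<noteq> y"
    define t where "t = norm (x - y) / (2 * 1 * R)"
    have "norm (x - y) \<le> dist x z + dist z y" using dist_triangle[of x y z] by (simp add: dist_norm)
    then have t: "0 < t" "t \<le> 1" using x y xy R by (auto simp: t_def dist_commute)
    have "X t powr (1 / p) \<le> 1"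
      using X_bounds[OF t] p2 by (intro powr_le1) auto
    then have "\<bar>u x - u y\<bar> / norm (x - y) powr (1 - real CARD('n) / p) * X t powr (1 / p)
        \<le> \<bar>u x - u y\<bar> / norm (x - y) powr (1 - real CARD('n) / p)"
      by (intro mult_right_le_one_le) auto
    also have "\<dots> \<le> c * hardy_difference p (ball z R) u powr (1 / p)"
      using hoelder_estimate[OF x y xy] xy by (simp add: divide_le_eq c_def n_def mult_ac)
    finally show "ereal (\<bar>u x - u y\<bar> / norm (x - y) powr (1 - real CARD('n) / p)
        * X (norm (x - y) / (2 * 1 * R)) powr (1 / p)) \<le> ereal (c * hardy_difference p (ball z R) u powr (1 / p))"
      by (simp add: t_def)
  qed
qed simp

end
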